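(* For every $n\ge 3$ and every triangulation $\mathcal{T}$ of $P_n$ such that some triangle of $\mathcal{T}$ does not contain the vertex $0$, there exists a category with cofibrations $\mathcal{C}$ such that the $2$-Segal map $f_{\mathcal{T}}\colon S_n\mathcal{C}\to\operatorname{holim}_{I\in\mathcal{T}}S_I\mathcal{C}$ of the simplicial category $S_\bullet\mathcal{C}$ is not a weak equivalence, i.e. not an equivalence of categories.
   Context: A category with cofibrations is a (small) category $\mathcal{C}$ with a zero object $0$ and a distinguished class of morphisms, the cofibrations (written $\rightarrowtail$), such that: for every object $A$ the map $0\to A$ is a cofibration; every isomorphism is a cofibration; cofibrations are closed under composition; the pushout of a cofibration along any morphism exists and is a cofibration. A cofibration sequence $A\rightarrowtail B\twoheadrightarrow D$ is a cofibration followed by its cokernel, i.e. $D$ is a pushout of $0\leftarrow A\rightarrowtail B$. For a finite nonempty totally ordered set $I$ (e.g. $[n]=\{0<1<\dots<n\}$), $\mathrm{Ar}(I)$ is the poset of pairs $(i,j)$, $i\le j$ in $I$, with $(i,j)\le(i',j')$ iff $i\le i'$ and $j\le j'$. $S_I\mathcal{C}$ is the full subcategory of functors $A\colon \mathrm{Ar}(I)\to\mathcal{C}$, $(i,j)\mapsto A_{i,j}$, with $A_{j,j}=0$ for all $j$ and $A_{i,j}\rightarrowtail A_{i,k}\twoheadrightarrow A_{j,k}$ a cofibration sequence for all $i<j<k$; $S_n\mathcal{C}=S_{[n]}\mathcal{C}$. Precomposition makes $S_\bullet\mathcal{C}$ a simplicial category. $P_n$ is the regular $(n+1)$-gon with vertices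 labeled cyclically $0,1,\dots,n$. A triangulation $\mathcal{T}$ of $P_n$ is a subdivision into triangles with vertices among those of $P_n$; a diagonal is an edge of a triangle that is not an edge of $P_n$. Regard $\mathcal{T}$ as the poset (under inclusion) of vertex sets of its triangles and diagonals. The restriction functors $X_n\to X_I$ for $I\subseteq[n]$ (where $X_I\cong X_{|I|-1}$) induce the $2$-Segal map $f_{\mathcal{T}}\colon X_n\to\operatorname{holim}_{I\in\mathcal{T}}X_I$ of a simplicial category $X$; the target is the iterated homotopy fiber product of the $X_T$ ($T$ a triangle) over the $X_e$ ($e$ a diagonal). Homotopy limits of categories are taken in the canonical model structure on small categories (weak equivalences: equivalences of categories; cofibrations: functors injective on objects; fibrations: isofibrations). *)

theory Defs
  imports "HOL-Analysis.Analysis"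
begin

section \<open>Small categories, functors, equivalences\<close>

record ('o, 'm) cat =
  Obj :: "'o set"
  Arr :: "'m set"
  Dom :: "'m \<Rightarrow> 'o"
  Cod :: "'m \<Rightarrow> 'o"
  Idn :: "'o \<Rightarrow> 'm"
  Cmp :: "'m \<Rightarrow> 'm \<Rightarrow> 'm"  \<comment> \<open>\<open>Cmp C g f\<close> is \<open>g\<close> after \<open>f\<close>; only meaningful if \<open>Cod C f = Dom C g\<close>\<close>

definition hom :: "('o, 'm, 'z) cat_scheme \<Rightarrow> 'o \<Rightarrow> 'o \<Rightarrow> 'm set" where
  "hom C a b = {f \<in> Arr C. Dom C f = a \<and> Cod C f = b}"

locale category =
  fixes C :: "('o, 'm, 'z) cat_scheme"
  assumes Dom_Obj: "f \<in> Arr C \<Longrightarrow> Dom C f \<in> Obj C"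
    and Cod_Obj: "f \<in> Arr C \<Longrightarrow> Cod C f \<in> Obj C"
    and Idn_hom: "a \<in> Obj C \<Longrightarrow> Idn C a \<in> hom C a a"
    and Cmp_hom: "f \<in> hom C a b \<Longrightarrow> g \<in> hom C b c \<Longrightarrow> Cmp C g f \<in> hom C a c"
    and Cmp_Idn_left: "f \<in> hom C a b \<Longrightarrow> Cmp C (Idn C b) f = f"
    and Cmp_Idn_right: "f \<in> hom C a b \<Longrightarrow> Cmp C f (Idn C a) = f"
    and Cmp_assoc: "f \<in> hom C a b \<Longrightarrow> g \<in> hom C b c \<Longrightarrow> h \<in> hom C c d \<Longrightarrow>
                      Cmp C h (Cmp C g f) = Cmp C (Cmp C h g) f"

definition is_iso :: "('o, 'm, 'z) cat_scheme \<Rightarrow> 'm \<Rightarrow> bool" where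
  "is_iso C f \<longleftrightarrow> f \<in> Arr C \<and>
     (\<exists>g \<in> hom C (Cod C f) (Dom C f). Cmp C g f = Idn C (Dom C f) \<and> Cmp C f g = Idn C (Cod C f))"

definition isomorphic :: "('o, 'm, 'z) cat_scheme \<Rightarrow> 'o \<Rightarrow> 'o \<Rightarrow> bool" where
  "isomorphic C a b \<longleftrightarrow> (\<exists>f \<in> hom C a b. is_iso C f)"

text \<open>The maps of a functor and the components of a natural transformation are extensional
  (\<open>undefined\<close> off the carrier), so that HOL equality is equality of functors resp. of
  natural transformations.\<close>

record ('o, 'm, 'p, 'q) fctr =
  omap :: "'o \<Rightarrow> 'p"
  amap :: "'m \<Rightarrow> 'q"

definition is_functor ::
  "('o, 'm, 'y) cat_scheme \<Rightarrow> ('p, 'q, 'z) cat_scheme \<Rightarrow> ('o, 'm, 'p, 'q) fctr \<Rightarrow> bool" where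
  "is_functor C D F \<longleftrightarrow>
     omap F \<in> Obj C \<rightarrow>\<^sub>E Obj D \<and> amap F \<in> Arr C \<rightarrow>\<^sub>E Arr D \<and>
     (\<forall>f \<in> Arr C. amap F f \<in> hom D (omap F (Dom C f)) (omap F (Cod C f))) \<and>
     (\<forall>a \<in> Obj C. amap F (Idn C a) = Idn D (omap F a)) \<and>
     (\<forall>f \<in> Arr C. \<forall>g \<in> Arr C. Cod C f = Dom C g \<longrightarrow>
        amap F (Cmp C g f) = Cmp D (amap F g) (amap F f))"

definition id_fctr :: "('o, 'm, 'z) cat_scheme \<Rightarrow> ('o, 'm, 'o, 'm) fctr" where
  "id_fctr C = \<lparr>omap = (\<lambda>a \<in> Obj C. a), amap = (\<lambda>f \<in> Arr C. f)\<rparr>"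

definition comp_fctr :: "('o, 'm, 'z) cat_scheme \<Rightarrow> ('p, 'q, 'r, 's) fctr \<Rightarrow> ('o, 'm, 'p, 'q) fctr
    \<Rightarrow> ('o, 'm, 'r, 's) fctr" where
  "comp_fctr C G F =
     \<lparr>omap = (\<lambda>a \<in> Obj C. omap G (omap F a)), amap = (\<lambda>f \<in> Arr C. amap G (amap F f))\<rparr>"

definition nat_trans :: "('o, 'm, 'y) cat_scheme \<Rightarrow> ('p, 'q, 'z) cat_scheme \<Rightarrow>
    ('o, 'm, 'p, 'q) fctr \<Rightarrow> ('o, 'm, 'p, 'q) fctr \<Rightarrow> ('o \<Rightarrow> 'q) \<Rightarrow> bool" where
  "nat_trans D C F G \<tau> \<longleftrightarrow>
     \<tau> \<in> (\<Pi>\<^sub>E a \<in> Obj D. hom C (omap F a) (omap G a)) \<and>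
     (\<forall>f \<in> Arr D. Cmp C (\<tau> (Cod D f)) (amap F f) = Cmp C (amap G f) (\<tau> (Dom D f)))"

type_synonym ('a, 'b) tarr = "'a \<times> 'a \<times> 'b"

definition functor_cat :: "('o, 'm, 'y) cat_scheme \<Rightarrow> ('p, 'q, 'z) cat_scheme \<Rightarrow>
    (('o, 'm, 'p, 'q) fctr, (('o, 'm, 'p, 'q) fctr, 'o \<Rightarrow> 'q) tarr) cat" where
  "functor_cat D C =
     \<lparr>Obj = {F. is_functor D C F},
      Arr = {(F, G, \<tau>). is_functor D C F \<and> is_functor D C G \<and> nat_trans D C F G \<tau>},
      Dom = (\<lambda>(F, G, \<tau>). F),
      Cod = (\<lambda>(F, G, \<tau>). G),
      Idn = (\<lambda>F. (F, F, \<lambda>a \<in> Obj D. Idn C (omap F a))),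
      Cmp = (\<lambda>(G', H, \<sigma>) (F, G, \<tau>). (F, H, \<lambda>a \<in> Obj D. Cmp C (\<sigma> a) (\<tau> a)))\<rparr>"

definition full_subcat :: "('o, 'm) cat \<Rightarrow> ('o \<Rightarrow> bool) \<Rightarrow> ('o, 'm) cat" where
  "full_subcat C P = C\<lparr>Obj := {a \<in> Obj C. P a}, Arr := {f \<in> Arr C. P (Dom C f) \<and> P (Cod C f)}\<rparr>"

definition equivalence_of_categories ::
  "('o, 'm, 'y) cat_scheme \<Rightarrow> ('p, 'q, 'z) cat_scheme \<Rightarrow> ('o, 'm, 'p, 'q) fctr \<Rightarrow> bool" where
  "equivalence_of_categories C D F \<longleftrightarrow> is_functor C D F \<and>
     (\<exists>G. is_functor D C G \<and>
          isomorphic (functor_cat C C) (comp_fctr C G F) (id_fctr C) \<and>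
          isomorphic (functor_cat D D) (comp_fctr D F G) (id_fctr D))"


section \<open>Categories with cofibrations\<close>

definition is_pushout :: "('o, 'm, 'z) cat_scheme \<Rightarrow> 'm \<Rightarrow> 'm \<Rightarrow> 'm \<Rightarrow> 'm \<Rightarrow> bool" where
  \<comment> \<open>the square with span \<open>f : A \<rightarrow> B\<close>, \<open>g : A \<rightarrow> E\<close> and cospan \<open>h : B \<rightarrow> D\<close>, \<open>k : E \<rightarrow> D\<close> is a pushout\<close>
  "is_pushout C f g h k \<longleftrightarrow>
     f \<in> Arr C \<and> g \<in> Arr C \<and> Dom C g = Dom C f \<and>
     h \<in> Arr C \<and> k \<in> Arr C \<and> Dom C h = Cod C f \<and> Dom C k = Cod C g \<and> Cod C k = Cod C h \<and>
     Cmp C h f = Cmp C k g \<and>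
     (\<forall>z \<in> Obj C. \<forall>u \<in> hom C (Cod C f) z. \<forall>v \<in> hom C (Cod C g) z.
        Cmp C u f = Cmp C v g \<longrightarrow>
        (\<exists>!w. w \<in> hom C (Cod C h) z \<and> Cmp C w h = u \<and> Cmp C w k = v))"

record ('o, 'm) cof_cat = "('o, 'm) cat" +
  Zero :: "'o"
  Cof :: "'m set"

locale category_with_cofibrations = category C
  for C :: "('o, 'm, 'z) cof_cat_scheme" +
  assumes Zero_Obj: "Zero C \<in> Obj C"
    and Zero_initial: "a \<in> Obj C \<Longrightarrow> \<exists>!f. f \<in> hom C (Zero C) a"
    and Zero_terminal: "a \<in> Obj C \<Longrightarrow> \<exists>!f. f \<in> hom C a (Zero C)"
    and Cof_Arr: "Cof C \<subseteq> Arr C"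
    and Cof_Zero: "a \<in> Obj C \<Longrightarrow> f \<in> hom C (Zero C) a \<Longrightarrow> f \<in> Cof C"
    and Cof_iso: "is_iso C f \<Longrightarrow> f \<in> Cof C"
    and Cof_Cmp: "f \<in> Cof C \<Longrightarrow> g \<in> Cof C \<Longrightarrow> Cod C f = Dom C g \<Longrightarrow> Cmp C g f \<in> Cof C"
    and Cof_pushout_exists:
      "f \<in> Cof C \<Longrightarrow> g \<in> Arr C \<Longrightarrow> Dom C g = Dom C f \<Longrightarrow> \<exists>h k. is_pushout C f g h k"
    and Cof_pushout: "f \<in> Cof C \<Longrightarrow> is_pushout C f g h k \<Longrightarrow> k \<in> Cof C"

definition cofibration_sequence :: "('o, 'm, 'z) cof_cat_scheme \<Rightarrow> 'm \<Rightarrow> 'm \<Rightarrow> bool" where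
  "cofibration_sequence C i p \<longleftrightarrow>
     i \<in> Cof C \<and> p \<in> Arr C \<and> Dom C p = Cod C i \<and>
     (\<exists>t \<in> hom C (Dom C i) (Zero C). \<exists>z \<in> hom C (Zero C) (Cod C p). is_pushout C i t p z)"


section \<open>The simplicial category \<open>S\<close>\<close>

definition poset_cat :: "'a set \<Rightarrow> ('a \<Rightarrow> 'a \<Rightarrow> bool) \<Rightarrow> ('a, 'a \<times> 'a) cat" where
  "poset_cat P le =
     \<lparr>Obj = P, Arr = {(x, y). x \<in> P \<and> y \<in> P \<and> le x y}, Dom = fst, Cod = snd,
      Idn = (\<lambda>x. (x, x)), Cmp = (\<lambda>(y', z) (x, y). (x, z))\<rparr>"

type_synonym ar = "nat \<times> nat"

definition Ar :: "nat set \<Rightarrow> (ar, ar \<times> ar) cat" where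
  "Ar I = poset_cat {(i, j). i \<in> I \<and> j \<in> I \<and> i \<le> j} (\<lambda>(i, j) (i', j'). i \<le> i' \<and> j \<le> j')"

type_synonym ('o, 'm) Sobj = "(ar, ar \<times> ar, 'o, 'm) fctr"
type_synonym ('o, 'm) Sarr = "(('o, 'm) Sobj, ar \<Rightarrow> 'm) tarr"

definition Sdot :: "('o, 'm, 'z) cof_cat_scheme \<Rightarrow> nat set \<Rightarrow> (('o, 'm) Sobj, ('o, 'm) Sarr) cat" where
  "Sdot C I = full_subcat (functor_cat (Ar I) C)
     (\<lambda>A. (\<forall>j \<in> I. omap A (j, j) = Zero C) \<and>
          (\<forall>i \<in> I. \<forall>j \<in> I. \<forall>k \<in> I. i < j \<and> j < k \<longrightarrow>
             cofibration_sequence C (amap A ((i, j), (i, k))) (amap A ((i, k), (j, k)))))"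

definition Ar_map :: "nat set \<Rightarrow> (nat \<Rightarrow> nat) \<Rightarrow> (ar, ar \<times> ar, ar, ar \<times> ar) fctr" where
  "Ar_map I \<theta> =
     \<lparr>omap = (\<lambda>x \<in> Obj (Ar I). map_prod \<theta> \<theta> x),
      amap = (\<lambda>f \<in> Arr (Ar I). map_prod (map_prod \<theta> \<theta>) (map_prod \<theta> \<theta>) f)\<rparr>"

definition Sdot_map :: "('o, 'm, 'z) cof_cat_scheme \<Rightarrow> nat set \<Rightarrow> nat set \<Rightarrow> (nat \<Rightarrow> nat) \<Rightarrow>
    (('o, 'm) Sobj, ('o, 'm) Sarr, ('o, 'm) Sobj, ('o, 'm) Sarr) fctr" where
  \<comment> \<open>the functor \<open>S\<^sub>J C \<rightarrow> S\<^sub>I C\<close> given by precomposition with a monotone map \<open>\<theta> : I \<rightarrow> J\<close>\<close>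
  "Sdot_map C J I \<theta> =
     \<lparr>omap = (\<lambda>A \<in> Obj (Sdot C J). comp_fctr (Ar I) A (Ar_map I \<theta>)),
      amap = (\<lambda>(A, B, \<tau>) \<in> Arr (Sdot C J).
                (comp_fctr (Ar I) A (Ar_map I \<theta>), comp_fctr (Ar I) B (Ar_map I \<theta>),
                 \<lambda>x \<in> Obj (Ar I). \<tau> (omap (Ar_map I \<theta>) x)))\<rparr>"

abbreviation Sdot_res :: "('o, 'm, 'z) cof_cat_scheme \<Rightarrow> nat set \<Rightarrow> nat set \<Rightarrow>
    (('o, 'm) Sobj, ('o, 'm) Sarr, ('o, 'm) Sobj, ('o, 'm) Sarr) fctr" where
  "Sdot_res C J I \<equiv> Sdot_map C J I (\<lambda>i. i)"


section \<open>Homotopy limits of categories\<close>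

text \<open>Let \<open>X\<close> be a diagram of categories indexed by a poset \<open>(K, le)\<close>, with transition functors
  \<open>R I J : X I \<rightarrow> X J\<close> for \<open>le I J\<close>. In the canonical model structure, which is simplicial
  with cotensor \<open>Fun(\<Pi>\<^sub>1 N, -)\<close> by a simplicial set \<open>N\<close>, all categories are fibrant. So the homotopy
  limit is the end of the categories of functors from the fundamental groupoid of the nerve of the
  poset of elements over \<open>I\<close> to \<open>X I\<close>. These groupoids are contractible, hence an object of the end
  amounts to objects \<open>x I\<close> of \<open>X I\<close> with a coherent family of isomorphisms
  \<open>\<phi> (I, J) : R I J (x I) \<rightarrow> x J\<close>, i.e. the end is the pseudo-limit of the diagram. For the poset
  of triangles and diagonals it is the iterated homotopy fiber product, where
  \<open>X I \<times>\<^sup>h X J\<close> over \<open>X e\<close> consists of objects of the three categories and isomorphisms in \<open>X e\<close>.\<close>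

definition le_pairs :: "'i set \<Rightarrow> ('i \<Rightarrow> 'i \<Rightarrow> bool) \<Rightarrow> ('i \<times> 'i) set" where
  "le_pairs K le = {(I, J). I \<in> K \<and> J \<in> K \<and> le I J}"

definition holim_obj :: "'i set \<Rightarrow> ('i \<Rightarrow> 'i \<Rightarrow> bool) \<Rightarrow> ('i \<Rightarrow> ('o, 'm) cat) \<Rightarrow>
    ('i \<Rightarrow> 'i \<Rightarrow> ('o, 'm, 'o, 'm) fctr) \<Rightarrow> ('i \<Rightarrow> 'o) \<Rightarrow> ('i \<times> 'i \<Rightarrow> 'm) \<Rightarrow> bool" where
  "holim_obj K le X R x \<phi> \<longleftrightarrow>
     x \<in> (\<Pi>\<^sub>E I \<in> K. Obj (X I)) \<and>
     \<phi> \<in> extensional (le_pairs K le) \<and>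
     (\<forall>(I, J) \<in> le_pairs K le. \<phi> (I, J) \<in> hom (X J) (omap (R I J) (x I)) (x J) \<and> is_iso (X J) (\<phi> (I, J))) \<and>
     (\<forall>I \<in> K. \<phi> (I, I) = Idn (X I) (x I)) \<and>
     (\<forall>I \<in> K. \<forall>J \<in> K. \<forall>L \<in> K. le I J \<and> le J L \<longrightarrow>
        \<phi> (I, L) = Cmp (X L) (\<phi> (J, L)) (amap (R J L) (\<phi> (I, J))))"

definition holim_arr :: "'i set \<Rightarrow> ('i \<Rightarrow> 'i \<Rightarrow> bool) \<Rightarrow> ('i \<Rightarrow> ('o, 'm) cat) \<Rightarrow>
    ('i \<Rightarrow> 'i \<Rightarrow> ('o, 'm, 'o, 'm) fctr) \<Rightarrow> ('i \<Rightarrow> 'o) \<times> ('i \<times> 'i \<Rightarrow> 'm) \<Rightarrow>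
    ('i \<Rightarrow> 'o) \<times> ('i \<times> 'i \<Rightarrow> 'm) \<Rightarrow> ('i \<Rightarrow> 'm) \<Rightarrow> bool" where
  "holim_arr K le X R = (\<lambda>(x, \<phi>) (y, \<psi>) u.
     u \<in> (\<Pi>\<^sub>E I \<in> K. hom (X I) (x I) (y I)) \<and>
     (\<forall>(I, J) \<in> le_pairs K le.
        Cmp (X J) (\<psi> (I, J)) (amap (R I J) (u I)) = Cmp (X J) (u J) (\<phi> (I, J))))"

definition holim :: "'i set \<Rightarrow> ('i \<Rightarrow> 'i \<Rightarrow> bool) \<Rightarrow> ('i \<Rightarrow> ('o, 'm) cat) \<Rightarrow>
    ('i \<Rightarrow> 'i \<Rightarrow> ('o, 'm, 'o, 'm) fctr) \<Rightarrow>
    (('i \<Rightarrow> 'o) \<times> ('i \<times> 'i \<Rightarrow> 'm), (('i \<Rightarrow> 'o) \<times> ('i \<times> 'i \<Rightarrow> 'm), 'i \<Rightarrow> 'm) tarr) cat" where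
  "holim K le X R =
     \<lparr>Obj = {(x, \<phi>). holim_obj K le X R x \<phi>},
      Arr = {(p, q, u). case_prod (holim_obj K le X R) p \<and> case_prod (holim_obj K le X R) q \<and>
                        holim_arr K le X R p q u},
      Dom = (\<lambda>(p, q, u). p),
      Cod = (\<lambda>(p, q, u). q),
      Idn = (\<lambda>p. (p, p, \<lambda>I \<in> K. Idn (X I) (fst p I))),
      Cmp = (\<lambda>(q', r, v) (p, q, u). (p, r, \<lambda>I \<in> K. Cmp (X I) (v I) (u I)))\<rparr>"


section \<open>Triangulations and the 2-Segal map\<close>

definition polygon_vertex :: "nat \<Rightarrow> nat \<Rightarrow> complex" where
  "polygon_vertex n k = cis (2 * pi * real k / real (n + 1))"

text \<open>A triangulation of the regular \<open>(n+1)\<close>-gon is given by the set of vertex sets of its triangles.\<close>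

definition polygon_triangulation :: "nat \<Rightarrow> nat set set \<Rightarrow> bool" where
  "polygon_triangulation n \<Delta> \<longleftrightarrow>
     (\<forall>t \<in> \<Delta>. t \<subseteq> {0..n} \<and> card t = 3) \<and>
     triangulation ((\<lambda>t. convex hull (polygon_vertex n ` t)) ` \<Delta>) \<and>
     (\<Union>t \<in> \<Delta>. convex hull (polygon_vertex n ` t)) = convex hull (polygon_vertex n ` {0..n})"

definition polygon_edges :: "nat \<Rightarrow> nat set set" where
  "polygon_edges n = {{i, Suc i} | i. i < n} \<union> {{n, 0}}"

definition diagonals :: "nat \<Rightarrow> nat set set \<Rightarrow> nat set set" where
  "diagonals n \<Delta> = {e. card e = 2 \<and> (\<exists>t \<in> \<Delta>. e \<subseteq> t) \<and> e \<notin> polygon_edges n}"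

text \<open>In the following, \<open>X I\<close> is the category of \<open>I\<close>-simplices of a simplicial category, for \<open>I \<subseteq> {0..n}\<close>
  nonempty, and \<open>R J I : X J \<rightarrow> X I\<close> is restriction along \<open>I \<subseteq> J\<close>. This is contravariant for
  inclusion, hence the reversed order on the poset of triangles and diagonals.\<close>

definition two_segal_target :: "(nat set \<Rightarrow> ('o, 'm) cat) \<Rightarrow>
    (nat set \<Rightarrow> nat set \<Rightarrow> ('o, 'm, 'o, 'm) fctr) \<Rightarrow> nat \<Rightarrow> nat set set \<Rightarrow>
    ((nat set \<Rightarrow> 'o) \<times> (nat set \<times> nat set \<Rightarrow> 'm),
     ((nat set \<Rightarrow> 'o) \<times> (nat set \<times> nat set \<Rightarrow> 'm), nat set \<Rightarrow> 'm) tarr) cat" where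
  "two_segal_target X R n \<Delta> = holim (\<Delta> \<union> diagonals n \<Delta>) (\<lambda>I J. J \<subseteq> I) X R"

definition two_segal_map :: "(nat set \<Rightarrow> ('o, 'm) cat) \<Rightarrow>
    (nat set \<Rightarrow> nat set \<Rightarrow> ('o, 'm, 'o, 'm) fctr) \<Rightarrow> nat \<Rightarrow> nat set set \<Rightarrow>
    ('o, 'm, (nat set \<Rightarrow> 'o) \<times> (nat set \<times> nat set \<Rightarrow> 'm),
     ((nat set \<Rightarrow> 'o) \<times> (nat set \<times> nat set \<Rightarrow> 'm), nat set \<Rightarrow> 'm) tarr) fctr" where
  "two_segal_map X R n \<Delta> =
     (let K = \<Delta> \<union> diagonals n \<Delta>;
          F = (\<lambda>x. (\<lambda>I \<in> K. omap (R {0..n} I) x,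
                    \<lambda>(I, J) \<in> le_pairs K (\<lambda>I J. J \<subseteq> I). Idn (X J) (omap (R {0..n} J) x)))
      in \<lparr>omap = (\<lambda>x \<in> Obj (X {0..n}). F x),
          amap = (\<lambda>f \<in> Arr (X {0..n}).
                    (F (Dom (X {0..n}) f), F (Cod (X {0..n}) f), \<lambda>I \<in> K. amap (R {0..n} I) f))\<rparr>)"


section \<open>Well-definedness\<close>

lemma category_poset_cat:
  assumes "\<And>x. x \<in> P \<Longrightarrow> le x x"
    and "\<And>x y z. x \<in> P \<Longrightarrow> y \<in> P \<Longrightarrow> z \<in> P \<Longrightarrow> le x y \<Longrightarrow> le y z \<Longrightarrow> le x z"
  shows "category (poset_cat P le)"
proof
  fix f g a b c
  assume "f \<in> hom (poset_cat P le) a b" "g \<in> hom (poset_cat P le) b c"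
  then have "f = (a, b)" "g = (b, c)" "a \<in> P" "b \<in> P" "c \<in> P" "le a b" "le b c"
    by (auto simp: poset_cat_def hom_def)
  with assms(2)[of a b c] show "Cmp (poset_cat P le) g f \<in> hom (poset_cat P le) a c"
    by (simp add: poset_cat_def hom_def)
qed (auto simp: poset_cat_def hom_def assms(1))

lemma category_Ar: "category (Ar I)"
  unfolding Ar_def by (rule category_poset_cat) auto

lemma nat_transD:
  assumes "nat_trans D C F G \<tau>"
  shows "a \<in> Obj D \<Longrightarrow> \<tau> a \<in> hom C (omap F a) (omap G a)"
    and "f \<in> Arr D \<Longrightarrow> Cmp C (\<tau> (Cod D f)) (amap F f) = Cmp C (amap G f) (\<tau> (Dom D f))"
  using assms unfolding nat_trans_def by auto

lemma is_functorD:
  assumes "is_functor C D F"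
  shows "a \<in> Obj C \<Longrightarrow> omap F a \<in> Obj D"
    and "f \<in> Arr C \<Longrightarrow> amap F f \<in> hom D (omap F (Dom C f)) (omap F (Cod C f))"
    and "a \<in> Obj C \<Longrightarrow> amap F (Idn C a) = Idn D (omap F a)"
    and "f \<in> Arr C \<Longrightarrow> g \<in> Arr C \<Longrightarrow> Cod C f = Dom C g \<Longrightarrow>
           amap F (Cmp C g f) = Cmp D (amap F g) (amap F f)"
  using assms unfolding is_functor_def by auto

lemma nat_trans_Idn:
  assumes "category D" "category C" "is_functor D C F"
  shows "nat_trans D C F F (\<lambda>a \<in> Obj D. Idn C (omap F a))"
proof -
  interpret D: category D by fact
  interpret C: category C by fact
  note F = is_functorD[OF assms(3)]
  show ?thesis
    unfolding nat_trans_def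
    using F(1) C.Cmp_Idn_left[OF F(2)] C.Cmp_Idn_right[OF F(2)] C.Idn_hom D.Dom_Obj D.Cod_Obj
    by simp
qed

lemma nat_trans_Cmp:
  assumes "category D" "category C" "is_functor D C F" "is_functor D C G" "is_functor D C H"
    and s: "nat_trans D C G H \<sigma>" and t: "nat_trans D C F G \<tau>"
  shows "nat_trans D C F H (\<lambda>a \<in> Obj D. Cmp C (\<sigma> a) (\<tau> a))"
proof -
  interpret D: category D by fact
  interpret C: category C by fact
  note S = nat_transD[OF s] and T = nat_transD[OF t]
  have "Cmp C (Cmp C (\<sigma> (Cod D f)) (\<tau> (Cod D f))) (amap F f) =
        Cmp C (amap H f) (Cmp C (\<sigma> (Dom D f)) (\<tau> (Dom D f)))" if f: "f \<in> Arr D" for f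
  proof -
    let ?a = "Dom D f" and ?b = "Cod D f"
    note ab = D.Dom_Obj[OF f] D.Cod_Obj[OF f]
    note F = is_functorD(2)[OF assms(3) f] and G = is_functorD(2)[OF assms(4) f]
      and H = is_functorD(2)[OF assms(5) f]
    have "Cmp C (Cmp C (\<sigma> ?b) (\<tau> ?b)) (amap F f) = Cmp C (\<sigma> ?b) (Cmp C (\<tau> ?b) (amap F f))"
      using C.Cmp_assoc[OF F T(1)[OF ab(2)] S(1)[OF ab(2)]] by simp
    also have "\<dots> = Cmp C (\<sigma> ?b) (Cmp C (amap G f) (\<tau> ?a))" using T(2)[OF f] by simp
    also have "\<dots> = Cmp C (Cmp C (\<sigma> ?b) (amap G f)) (\<tau> ?a)"
      using C.Cmp_assoc[OF T(1)[OF ab(1)] G S(1)[OF ab(2)]] by simp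
    also have "\<dots> = Cmp C (Cmp C (amap H f) (\<sigma> ?a)) (\<tau> ?a)" using S(2)[OF f] by simp
    also have "\<dots> = Cmp C (amap H f) (Cmp C (\<sigma> ?a) (\<tau> ?a))"
      using C.Cmp_assoc[OF T(1)[OF ab(1)] S(1)[OF ab(1)] H] by simp
    finally show ?thesis .
  qed
  moreover have "Cmp C (\<sigma> a) (\<tau> a) \<in> hom C (omap F a) (omap H a)" if "a \<in> Obj D" for a
    using S(1)[OF that] T(1)[OF that] C.Cmp_hom by blast
  ultimately show ?thesis
    unfolding nat_trans_def by (auto simp: D.Dom_Obj D.Cod_Obj)
qed

lemma nat_trans_ext:
  "nat_trans D C F G \<tau> \<Longrightarrow> (\<And>a. a \<in> Obj D \<Longrightarrow> f a = \<tau> a) \<Longrightarrow> (\<lambda>a \<in> Obj D. f a) = \<tau>"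
  unfolding nat_trans_def by (auto simp: PiE_def extensional_def restrict_def fun_eq_iff)

lemma category_functor_cat:
  assumes "category D" "category C"
  shows "category (functor_cat D C)"
proof -
  interpret D: category D by fact
  interpret C: category C by fact
  have h: "(F, G, \<tau>) \<in> hom (functor_cat D C) F' G' \<longleftrightarrow>
     F = F' \<and> G = G' \<and> is_functor D C F \<and> is_functor D C G \<and> nat_trans D C F G \<tau>" for F G \<tau> F' G'
    by (auto simp: hom_def functor_cat_def)
  have hE: "\<exists>\<tau>. f = (F, G, \<tau>)" if "f \<in> hom (functor_cat D C) F G" for f F G
    using that by (auto simp: hom_def functor_cat_def)
  show ?thesis
  proof
    fix f assume "f \<in> Arr (functor_cat D C)"
    then show "Dom (functor_cat D C) f \<in> Obj (functor_cat D C)"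
      "Cod (functor_cat D C) f \<in> Obj (functor_cat D C)" by (auto simp: functor_cat_def)
  next
    fix F assume "F \<in> Obj (functor_cat D C)"
    then show "Idn (functor_cat D C) F \<in> hom (functor_cat D C) F F"
      using nat_trans_Idn[OF assms, of F] by (simp add: functor_cat_def hom_def)
  next
    fix f g F G H
    assume f: "f \<in> hom (functor_cat D C) F G" and g: "g \<in> hom (functor_cat D C) G H"
    obtain \<tau> \<sigma> where e: "f = (F, G, \<tau>)" "g = (G, H, \<sigma>)" using hE[OF f] hE[OF g] by blast
    have "is_functor D C F" "is_functor D C G" "is_functor D C H" "nat_trans D C F G \<tau>" "nat_trans D C G H \<sigma>"
      using f g unfolding e h by simp_all
    with nat_trans_Cmp[OF assms this(1-3) this(5,4)]
    show "Cmp (functor_cat D C) g f \<in> hom (functor_cat D C) F H"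
      unfolding e by (simp add: functor_cat_def hom_def)
  next
    fix f F G
    assume f: "f \<in> hom (functor_cat D C) F G"
    obtain \<tau> where e: "f = (F, G, \<tau>)" using hE[OF f] by blast
    then have t: "nat_trans D C F G \<tau>" using f h by simp
    have "(\<lambda>a \<in> Obj D. Cmp C ((\<lambda>a \<in> Obj D. Idn C (omap G a)) a) (\<tau> a)) = \<tau>"
      "(\<lambda>a \<in> Obj D. Cmp C (\<tau> a) ((\<lambda>a \<in> Obj D. Idn C (omap F a)) a)) = \<tau>"
      by (rule nat_trans_ext[OF t],
          simp add: C.Cmp_Idn_left[OF nat_transD(1)[OF t]] C.Cmp_Idn_right[OF nat_transD(1)[OF t]])+
    then show "Cmp (functor_cat D C) (Idn (functor_cat D C) G) f = f"
      "Cmp (functor_cat D C) f (Idn (functor_cat D C) F) = f"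
      unfolding e by (simp_all add: functor_cat_def)
  next
    fix f g k F G H K
    assume f: "f \<in> hom (functor_cat D C) F G" and g: "g \<in> hom (functor_cat D C) G H"
      and k: "k \<in> hom (functor_cat D C) H K"
    obtain \<tau> \<sigma> \<rho> where e: "f = (F, G, \<tau>)" "g = (G, H, \<sigma>)" "k = (H, K, \<rho>)" using hE[OF f] hE[OF g] hE[OF k] by blast
    then have t: "nat_trans D C F G \<tau>" "nat_trans D C G H \<sigma>" "nat_trans D C H K \<rho>" using f g k h by simp_all
    show "Cmp (functor_cat D C) k (Cmp (functor_cat D C) g f) =
          Cmp (functor_cat D C) (Cmp (functor_cat D C) k g) f"
      unfolding e using C.Cmp_assoc[OF nat_transD(1)[OF t(1)] nat_transD(1)[OF t(2)] nat_transD(1)[OF t(3)]]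
      by (simp add: functor_cat_def cong: restrict_cong)
  qed
qed

lemma hom_full_subcat: "hom (full_subcat C P) a b = {f \<in> hom C a b. P a \<and> P b}"
  by (auto simp: full_subcat_def hom_def)

lemma full_subcat_simps:
  "Obj (full_subcat C P) = {a \<in> Obj C. P a}" "Dom (full_subcat C P) = Dom C"
  "Cod (full_subcat C P) = Cod C" "Cmp (full_subcat C P) = Cmp C" "Idn (full_subcat C P) = Idn C"
  "Arr (full_subcat C P) = {f \<in> Arr C. P (Dom C f) \<and> P (Cod C f)}"
  by (auto simp: full_subcat_def)

lemma category_full_subcat:
  assumes "category C"
  shows "category (full_subcat C P)"
proof -
  interpret category C by fact
  show ?thesis
    by unfold_locales
       (simp_all add: hom_full_subcat full_subcat_simps Dom_Obj Cod_Obj Idn_hom, (elim conjE,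
         (erule (1) Cmp_hom | erule Cmp_Idn_left | erule Cmp_Idn_right | erule (2) Cmp_assoc))+)
qed

lemma category_Sdot: "category C \<Longrightarrow> category (Sdot C I)"
  unfolding Sdot_def by (intro category_full_subcat category_functor_cat category_Ar)

lemma is_functor_comp:
  assumes "category C" "is_functor C D F" "is_functor D E G"
  shows "is_functor C E (comp_fctr C G F)"
proof -
  interpret C: category C by fact
  note F = is_functorD[OF assms(2)] and G = is_functorD[OF assms(3)]
  have 1: "f \<in> Arr C \<Longrightarrow> amap F f \<in> Arr D \<and> Dom D (amap F f) = omap F (Dom C f) \<and>
     Cod D (amap F f) = omap F (Cod C f)" for f using F(2)[of f] by (auto simp: hom_def)
  have 2: "f \<in> Arr C \<Longrightarrow> amap G (amap F f) \<in> hom E (omap G (omap F (Dom C f))) (omap G (omap F (Cod C f)))" for f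
    using G(2)[of "amap F f"] 1[of f] by auto
  have 3: "a \<in> Obj C \<Longrightarrow> Idn C a \<in> Arr C" for a using C.Idn_hom by (auto simp: hom_def)
  have 4: "f \<in> Arr C \<Longrightarrow> g \<in> Arr C \<Longrightarrow> Cod C f = Dom C g \<Longrightarrow> Cmp C g f \<in> Arr C" for f g
    using C.Cmp_hom[of f "Dom C f" "Cod C f" g "Cod C g"] by (auto simp: hom_def)
  show ?thesis unfolding is_functor_def
  proof (intro conjI ballI impI)
    show "omap (comp_fctr C G F) \<in> Obj C \<rightarrow>\<^sub>E Obj E"
      using F(1) G(1) by (simp add: comp_fctr_def)
    show "amap (comp_fctr C G F) \<in> Arr C \<rightarrow>\<^sub>E Arr E"
      using 2 by (simp add: comp_fctr_def hom_def)
  next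
    fix f assume f: "f \<in> Arr C"
    show "amap (comp_fctr C G F) f \<in> hom E (omap (comp_fctr C G F) (Dom C f)) (omap (comp_fctr C G F) (Cod C f))"
      using 2[OF f] f C.Dom_Obj[OF f] C.Cod_Obj[OF f] by (simp add: comp_fctr_def)
    fix g assume g: "g \<in> Arr C" "Cod C f = Dom C g"
    show "amap (comp_fctr C G F) (Cmp C g f) = Cmp E (amap (comp_fctr C G F) g) (amap (comp_fctr C G F) f)"
      using f g 1[OF f] 1[OF g(1)] 4[OF f g] F(4)[OF f g] G(4)[of "amap F f" "amap F g"]
      by (simp add: comp_fctr_def)
  next
    fix a assume a: "a \<in> Obj C"
    show "amap (comp_fctr C G F) (Idn C a) = Idn E (omap (comp_fctr C G F) a)"
      using a 3[OF a] F(3)[OF a] G(3)[OF F(1)[OF a]] by (simp add: comp_fctr_def)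
  qed
qed

lemma Ar_simps:
  "Obj (Ar I) = {(i, j). i \<in> I \<and> j \<in> I \<and> i \<le> j}"
  "Arr (Ar I) = {((i, j), (i', j')). i \<in> I \<and> j \<in> I \<and> i \<le> j \<and> i' \<in> I \<and> j' \<in> I \<and> i' \<le> j' \<and> i \<le> i' \<and> j \<le> j'}"
  "Dom (Ar I) = fst" "Cod (Ar I) = snd" "Idn (Ar I) x = (x, x)" "Cmp (Ar I) g f = (fst f, snd g)"
  by (auto simp: Ar_def poset_cat_def split: prod.splits)

lemma is_functor_Ar_map:
  assumes "mono_on I \<theta>" "\<theta> ` I \<subseteq> J"
  shows "is_functor (Ar I) (Ar J) (Ar_map I \<theta>)"
  unfolding is_functor_def hom_def Ar_map_def
  using assms by (auto simp: Ar_simps mono_on_def)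

lemma is_pushout_zero_id:
  assumes "category_with_cofibrations C" "a \<in> Obj C" "z \<in> hom C (Zero C) a"
  shows "cofibration_sequence C z (Idn C a)"
    "t \<in> hom C a (Zero C) \<Longrightarrow> cofibration_sequence C (Idn C a) t"
proof -
  interpret category_with_cofibrations C by fact
  note hh = hom_def[of C]
  have i0: "Idn C (Zero C) \<in> hom C (Zero C) (Zero C)" using Idn_hom Zero_Obj by auto
  have ia: "Idn C a \<in> hom C a a" using Idn_hom assms by auto
  have isoa: "is_iso C (Idn C a)" unfolding is_iso_def using ia Cmp_Idn_left[OF ia] by (auto simp: hom_def)
  have zu: "Cmp C v (Idn C (Zero C)) = v" if "v \<in> hom C (Zero C) b" for v b using Cmp_Idn_right that by blast
  have 1: "is_pushout C z (Idn C (Zero C)) (Idn C a) z"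
    unfolding is_pushout_def
  proof (intro conjI ballI impI)
    fix b u v assume b: "b \<in> Obj C" and u: "u \<in> hom C (Cod C z) b"
      and v: "v \<in> hom C (Cod C (Idn C (Zero C))) b" and e: "Cmp C u z = Cmp C v (Idn C (Zero C))"
    have u: "u \<in> hom C a b" and v: "v \<in> hom C (Zero C) b" using u v assms i0 by (auto simp: hom_def)
    show "\<exists>!w. w \<in> hom C (Cod C (Idn C a)) b \<and> Cmp C w (Idn C a) = u \<and> Cmp C w z = v"
    proof (rule ex1I[of _ u])
      show "u \<in> hom C (Cod C (Idn C a)) b \<and> Cmp C u (Idn C a) = u \<and> Cmp C u z = v"
        using u e zu[OF v] Cmp_Idn_right[OF u] ia by (simp add: hom_def)
    next
      fix w assume w: "w \<in> hom C (Cod C (Idn C a)) b \<and> Cmp C w (Idn C a) = u \<and> Cmp C w z = v"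
      then have "w \<in> hom C a b" using ia by (simp add: hom_def)
      from Cmp_Idn_right[OF this] w show "w = u" by simp
    qed
  qed (use i0 ia assms(3) Cmp_Idn_left[OF assms(3)] Cmp_Idn_right[OF assms(3)] in \<open>auto simp: hom_def\<close>)
  show "cofibration_sequence C z (Idn C a)"
    unfolding cofibration_sequence_def
    using 1 i0 ia assms Cof_Zero by (auto simp: hom_def intro!: bexI)
  assume t: "t \<in> hom C a (Zero C)"
  have 2: "is_pushout C (Idn C a) t t (Idn C (Zero C))"
    unfolding is_pushout_def
  proof (intro conjI ballI impI)
    fix b u v assume b: "b \<in> Obj C" and u: "u \<in> hom C (Cod C (Idn C a)) b"
      and v: "v \<in> hom C (Cod C t) b" and e: "Cmp C u (Idn C a) = Cmp C v t"
    have u: "u \<in> hom C a b" and v: "v \<in> hom C (Zero C) b" using u v t ia by (auto simp: hom_def)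
    show "\<exists>!w. w \<in> hom C (Cod C t) b \<and> Cmp C w t = u \<and> Cmp C w (Idn C (Zero C)) = v"
    proof (rule ex1I[of _ v])
      show "v \<in> hom C (Cod C t) b \<and> Cmp C v t = u \<and> Cmp C v (Idn C (Zero C)) = v"
        using v e Cmp_Idn_right[OF u] zu[OF v] t by (simp add: hom_def)
    next
      fix w assume w: "w \<in> hom C (Cod C t) b \<and> Cmp C w t = u \<and> Cmp C w (Idn C (Zero C)) = v"
      then have "w \<in> hom C (Zero C) b" using t by (simp add: hom_def)
      from zu[OF this] w show "w = v" by simp
    qed
  qed (use i0 ia t Cmp_Idn_left[OF t] Cmp_Idn_right[OF t] in \<open>auto simp: hom_def\<close>)
  show "cofibration_sequence C (Idn C a) t"
    unfolding cofibration_sequence_def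
    using 2 i0 ia t Cof_iso[OF isoa] by (auto simp: hom_def intro!: bexI)
qed

lemma Sdot_Obj: "A \<in> Obj (Sdot C I) \<longleftrightarrow> is_functor (Ar I) C A \<and> (\<forall>j \<in> I. omap A (j, j) = Zero C) \<and>
          (\<forall>i \<in> I. \<forall>j \<in> I. \<forall>k \<in> I. i < j \<and> j < k \<longrightarrow>
             cofibration_sequence C (amap A ((i, j), (i, k))) (amap A ((i, k), (j, k))))"
  unfolding Sdot_def full_subcat_simps by (auto simp: functor_cat_def)

lemma Sdot_Arr: "(A, B, \<tau>) \<in> Arr (Sdot C I) \<longleftrightarrow> A \<in> Obj (Sdot C I) \<and> B \<in> Obj (Sdot C I) \<and> nat_trans (Ar I) C A B \<tau>"
  unfolding Sdot_def full_subcat_simps by (auto simp: functor_cat_def)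

lemma Sdot_simps: "Dom (Sdot C I) = (\<lambda>(F, G, \<tau>). F)" "Cod (Sdot C I) = (\<lambda>(F, G, \<tau>). G)"
   "Idn (Sdot C I) = (\<lambda>F. (F, F, \<lambda>a \<in> Obj (Ar I). Idn C (omap F a)))"
   "Cmp (Sdot C I) = (\<lambda>(G', H, \<sigma>) (F, G, \<tau>). (F, H, \<lambda>a \<in> Obj (Ar I). Cmp C (\<sigma> a) (\<tau> a)))"
  unfolding Sdot_def full_subcat_simps by (auto simp: functor_cat_def)

lemma comp_Ar_map_simps:
  "\<lbrakk>i \<in> I; j \<in> I; i \<le> j\<rbrakk> \<Longrightarrow> omap (comp_fctr (Ar I) A (Ar_map I \<theta>)) (i, j) = omap A (\<theta> i, \<theta> j)"
  "\<lbrakk>i \<in> I; j \<in> I; i \<le> j; i' \<in> I; j' \<in> I; i' \<le> j'; i \<le> i'; j \<le> j'\<rbrakk> \<Longrightarrow>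
     amap (comp_fctr (Ar I) A (Ar_map I \<theta>)) ((i, j), (i', j')) = amap A ((\<theta> i, \<theta> j), (\<theta> i', \<theta> j'))"
  by (auto simp: comp_fctr_def Ar_map_def Ar_simps)

lemma Sdot_comp:
  assumes C: "category_with_cofibrations C" and m: "mono_on I \<theta>" "\<theta> ` I \<subseteq> J" and A: "A \<in> Obj (Sdot C J)"
  shows "comp_fctr (Ar I) A (Ar_map I \<theta>) \<in> Obj (Sdot C I)"
proof -
  interpret category_with_cofibrations C by fact
  note A = A[unfolded Sdot_Obj]
  let ?B = "comp_fctr (Ar I) A (Ar_map I \<theta>)"
  have f: "is_functor (Ar J) C A" using A by blast
  have id: "amap A (x, x) = Idn C (omap A x)" "omap A x \<in> Obj C" if "x \<in> Obj (Ar J)" for x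
    using is_functorD[OF f] that by (auto simp: Ar_simps)
  have ar: "amap A (x, y) \<in> hom C (omap A x) (omap A y)" if "(x, y) \<in> Arr (Ar J)" for x y
    using is_functorD(2)[OF f that] by (auto simp: Ar_simps)
  have "cofibration_sequence C (amap ?B ((i, j), (i, k))) (amap ?B ((i, k), (j, k)))"
    if i: "i \<in> I" "j \<in> I" "k \<in> I" "i < j" "j < k" for i j k
  proof -
    have J: "\<theta> i \<in> J" "\<theta> j \<in> J" "\<theta> k \<in> J" and le: "\<theta> i \<le> \<theta> j" "\<theta> j \<le> \<theta> k" "\<theta> i \<le> \<theta> k"
      using i m by (auto simp: mono_on_def)
    have "cofibration_sequence C (amap A ((\<theta> i, \<theta> j), (\<theta> i, \<theta> k))) (amap A ((\<theta> i, \<theta> k), (\<theta> j, \<theta> k)))"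
    proof (cases "\<theta> i < \<theta> j \<and> \<theta> j < \<theta> k")
      case True then show ?thesis using A J by blast
    next
      case False
      then consider "\<theta> i = \<theta> j" | "\<theta> j = \<theta> k" using le by linarith
      then show ?thesis
      proof cases
        case 1
        then show ?thesis
          using is_pushout_zero_id(1)[OF C, of "omap A (\<theta> j, \<theta> k)"] id[of "(\<theta> j, \<theta> k)"]
            ar[of "(\<theta> j, \<theta> j)" "(\<theta> j, \<theta> k)"] A J le by (auto simp: Ar_simps)
      next
        case 2
        then show ?thesis
          using is_pushout_zero_id(2)[OF C, of "omap A (\<theta> i, \<theta> k)"] id[of "(\<theta> i, \<theta> k)"]
            ar[of "(\<theta> i, \<theta> k)" "(\<theta> k, \<theta> k)"] ex1_implies_ex[OF Zero_initial[of "omap A (\<theta> i, \<theta> k)"]]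
            A J le by (auto simp: Ar_simps)
      qed
    qed
    then show ?thesis using i by (simp add: comp_Ar_map_simps)
  qed
  moreover have "omap ?B (j, j) = Zero C" if "j \<in> I" for j
    using that A m by (auto simp: comp_Ar_map_simps)
  moreover have "is_functor (Ar I) C ?B"
    by (rule is_functor_comp[OF category_Ar is_functor_Ar_map[OF m] f])
  ultimately show ?thesis unfolding Sdot_Obj by blast
qed

lemma Sdot_nat:
  assumes m: "mono_on I \<theta>" "\<theta> ` I \<subseteq> J" and t: "nat_trans (Ar J) C A B \<tau>"
  shows "nat_trans (Ar I) C (comp_fctr (Ar I) A (Ar_map I \<theta>)) (comp_fctr (Ar I) B (Ar_map I \<theta>))
           (\<lambda>x \<in> Obj (Ar I). \<tau> (omap (Ar_map I \<theta>) x))"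
  unfolding nat_trans_def
proof (intro conjI ballI)
  have o: "omap (Ar_map I \<theta>) x \<in> Obj (Ar J)" if "x \<in> Obj (Ar I)" for x
    using is_functorD(1)[OF is_functor_Ar_map[OF m] that] .
  show "(\<lambda>x\<in>Obj (Ar I). \<tau> (omap (Ar_map I \<theta>) x)) \<in> (\<Pi>\<^sub>E a\<in>Obj (Ar I). hom C (omap (comp_fctr (Ar I) A (Ar_map I \<theta>)) a) (omap (comp_fctr (Ar I) B (Ar_map I \<theta>)) a))"
    using nat_transD(1)[OF t o] by (auto simp: comp_fctr_def)
  fix f assume f: "f \<in> Arr (Ar I)"
  interpret Ar: category "Ar I" by (rule category_Ar)
  have a: "amap (Ar_map I \<theta>) f \<in> hom (Ar J) (omap (Ar_map I \<theta>) (Dom (Ar I) f)) (omap (Ar_map I \<theta>) (Cod (Ar I) f))"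
    using is_functorD(2)[OF is_functor_Ar_map[OF m] f] .
  then show "Cmp C ((\<lambda>x\<in>Obj (Ar I). \<tau> (omap (Ar_map I \<theta>) x)) (Cod (Ar I) f)) (amap (comp_fctr (Ar I) A (Ar_map I \<theta>)) f) =
         Cmp C (amap (comp_fctr (Ar I) B (Ar_map I \<theta>)) f) ((\<lambda>x\<in>Obj (Ar I). \<tau> (omap (Ar_map I \<theta>) x)) (Dom (Ar I) f))"
    using nat_transD(2)[OF t, of "amap (Ar_map I \<theta>) f"] f Ar.Dom_Obj[OF f] Ar.Cod_Obj[OF f]
    by (simp add: comp_fctr_def hom_def)
qed

lemma is_functor_Sdot_map:
  assumes C: "category_with_cofibrations C" and m: "mono_on I \<theta>" "\<theta> ` I \<subseteq> J"
  shows "is_functor (Sdot C J) (Sdot C I) (Sdot_map C J I \<theta>)"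
proof -
  have cC: "category C" using C by (simp add: category_with_cofibrations_def)
  interpret SJ: category "Sdot C J" by (rule category_Sdot[OF cC])
  note o = Sdot_comp[OF C m] and n = Sdot_nat[OF m]
  have th: "map_prod \<theta> \<theta> x \<in> Obj (Ar J)" if "x \<in> Obj (Ar I)" for x
    using that m by (auto simp: Ar_simps mono_on_def)
  have cA: "Cmp (Sdot C J) g f \<in> Arr (Sdot C J)" if "f \<in> Arr (Sdot C J)" "g \<in> Arr (Sdot C J)" "Cod (Sdot C J) f = Dom (Sdot C J) g" for f g
    using SJ.Cmp_hom[of f "Dom (Sdot C J) f" "Cod (Sdot C J) f" g "Cod (Sdot C J) g"] that
    by (auto simp: hom_def)
  show ?thesis
    unfolding is_functor_def
  proof (intro conjI ballI impI)
    show "omap (Sdot_map C J I \<theta>) \<in> Obj (Sdot C J) \<rightarrow>\<^sub>E Obj (Sdot C I)" using o by (auto simp: Sdot_map_def)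
    show "amap (Sdot_map C J I \<theta>) \<in> Arr (Sdot C J) \<rightarrow>\<^sub>E Arr (Sdot C I)" using o n by (auto simp: Sdot_map_def Sdot_Arr)
    fix f assume f: "f \<in> Arr (Sdot C J)"
    then show "amap (Sdot_map C J I \<theta>) f \<in> hom (Sdot C I) (omap (Sdot_map C J I \<theta>) (Dom (Sdot C J) f)) (omap (Sdot_map C J I \<theta>) (Cod (Sdot C J) f))"
      using o n by (cases f) (auto simp: Sdot_map_def Sdot_Arr hom_def Sdot_simps)
    fix g assume g: "g \<in> Arr (Sdot C J)" and e: "Cod (Sdot C J) f = Dom (Sdot C J) g"
    show "amap (Sdot_map C J I \<theta>) (Cmp (Sdot C J) g f) = Cmp (Sdot C I) (amap (Sdot_map C J I \<theta>) g) (amap (Sdot_map C J I \<theta>) f)"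
      using cA[OF f g e] f g e th
      by (cases f; cases g) (auto simp: Sdot_map_def Sdot_Arr Sdot_simps Ar_map_def intro!: restrict_ext)
  next
    fix A assume A: "A \<in> Obj (Sdot C J)"
    have "Idn (Sdot C J) A \<in> Arr (Sdot C J)" using SJ.Idn_hom[OF A] by (simp add: hom_def)
    then show "amap (Sdot_map C J I \<theta>) (Idn (Sdot C J) A) = Idn (Sdot C I) (omap (Sdot_map C J I \<theta>) A)"
      using A th by (auto simp: Sdot_map_def Sdot_simps Ar_map_def comp_fctr_def intro!: restrict_ext)
  qed
qed

lemma fctr_eqI:
  assumes "is_functor C D F" "is_functor C D G" "\<And>a. a \<in> Obj C \<Longrightarrow> omap F a = omap G a"
    "\<And>f. f \<in> Arr C \<Longrightarrow> amap F f = amap G f"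
  shows "F = G"
  using assms unfolding is_functor_def
  by (intro fctr.equality) (auto intro: PiE_ext simp del: PiE_iff)

lemma Sdot_map_id:
  assumes C: "category_with_cofibrations C"
  shows "Sdot_res C I I = id_fctr (Sdot C I)"
proof -
  have 1: "comp_fctr (Ar I) A (Ar_map I (\<lambda>i. i)) = A" if "A \<in> Obj (Sdot C I)" for A
    using that is_functor_comp[OF category_Ar is_functor_Ar_map[of I "\<lambda>i. i" I], of C A]
    by (intro fctr_eqI[of "Ar I" C]) (auto simp: Sdot_Obj comp_fctr_def Ar_map_def mono_on_def map_prod_def)
  have 2: "(\<lambda>x \<in> Obj (Ar I). \<tau> (omap (Ar_map I (\<lambda>i. i)) x)) = \<tau>" if "nat_trans (Ar I) C A B \<tau>" for A B \<tau>
    by (rule nat_trans_ext[OF that]) (auto simp: Ar_map_def map_prod_def)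
  show ?thesis
    unfolding Sdot_map_def id_fctr_def
    by (simp, intro conjI restrict_ext) (auto simp: 1 Sdot_Arr dest: 2)
qed

lemma Sdot_map_comp:
  assumes C: "category_with_cofibrations C" and m: "mono_on I \<theta>" "\<theta> ` I \<subseteq> J" "mono_on J \<eta>" "\<eta> ` J \<subseteq> L"
  shows "comp_fctr (Sdot C L) (Sdot_map C J I \<theta>) (Sdot_map C L J \<eta>) = Sdot_map C L I (\<eta> \<circ> \<theta>)"
proof -
  have th: "map_prod \<theta> \<theta> x \<in> Obj (Ar J)" if "x \<in> Obj (Ar I)" for x
    using that m by (auto simp: Ar_simps mono_on_def)
  have th2: "map_prod (map_prod \<theta> \<theta>) (map_prod \<theta> \<theta>) x \<in> Arr (Ar J)" if "x \<in> Arr (Ar I)" for x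
    using that m by (auto simp: Ar_simps mono_on_def)
  have 1: "comp_fctr (Ar I) (comp_fctr (Ar J) A (Ar_map J \<eta>)) (Ar_map I \<theta>) = comp_fctr (Ar I) A (Ar_map I (\<eta> \<circ> \<theta>))" for A
    using th th2 by (auto simp: comp_fctr_def Ar_map_def fun_eq_iff restrict_def map_prod_def split: prod.splits)
  have 2: "(\<lambda>x \<in> Obj (Ar I). (\<lambda>x \<in> Obj (Ar J). \<tau> (omap (Ar_map J \<eta>) x)) (omap (Ar_map I \<theta>) x))
         = (\<lambda>x \<in> Obj (Ar I). \<tau> (omap (Ar_map I (\<eta> \<circ> \<theta>)) x))" for \<tau> :: "ar \<Rightarrow> 'b"
    using th by (intro restrict_ext) (auto simp: Ar_map_def map_prod_def split: prod.splits)
  have a: "amap (Sdot_map C L J \<eta>) f \<in> Arr (Sdot C J)" if "f \<in> Arr (Sdot C L)" for f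
    using is_functorD(2)[OF is_functor_Sdot_map[OF C m(3,4)] that] by (simp add: hom_def)
  have o: "omap (Sdot_map C J I \<theta>) (omap (Sdot_map C L J \<eta>) A) = omap (Sdot_map C L I (\<eta> \<circ> \<theta>)) A"
    if "A \<in> Obj (Sdot C L)" for A
    using that Sdot_comp[OF C m(3,4) that] by (simp add: Sdot_map_def 1)
  have r: "amap (Sdot_map C J I \<theta>) (amap (Sdot_map C L J \<eta>) (A, B, \<tau>)) =
           amap (Sdot_map C L I (\<eta> \<circ> \<theta>)) (A, B, \<tau>)"
    if f: "(A, B, \<tau>) \<in> Arr (Sdot C L)" for A B \<tau>
    using f a[OF f] by (simp add: Sdot_map_def 1) (rule 2[simplified])
  have o': "(\<lambda>A \<in> Obj (Sdot C L). omap (Sdot_map C L I (\<eta> \<circ> \<theta>)) A) = omap (Sdot_map C L I (\<eta> \<circ> \<theta>))"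
    and r': "(\<lambda>f \<in> Arr (Sdot C L). amap (Sdot_map C L I (\<eta> \<circ> \<theta>)) f) = amap (Sdot_map C L I (\<eta> \<circ> \<theta>))"
    by (simp_all add: Sdot_map_def cong: restrict_cong)
  have 3: "(\<lambda>A \<in> Obj (Sdot C L). omap (Sdot_map C J I \<theta>) (omap (Sdot_map C L J \<eta>) A)) = omap (Sdot_map C L I (\<eta> \<circ> \<theta>))"
    by (subst o'[symmetric], rule restrict_ext, rule o)
  have 4: "(\<lambda>f \<in> Arr (Sdot C L). amap (Sdot_map C J I \<theta>) (amap (Sdot_map C L J \<eta>) f)) = amap (Sdot_map C L I (\<eta> \<circ> \<theta>))"
    by (subst r'[symmetric], rule restrict_ext) (metis prod_cases3 r)
  show ?thesis unfolding comp_fctr_def[of "Sdot C L"] 3 4 by simp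
qed

lemma holim_objD:
  assumes "holim_obj K le X R x \<phi>"
  shows "I \<in> K \<Longrightarrow> x I \<in> Obj (X I)"
    and "I \<in> K \<Longrightarrow> J \<in> K \<Longrightarrow> le I J \<Longrightarrow> \<phi> (I, J) \<in> hom (X J) (omap (R I J) (x I)) (x J)"
  using assms unfolding holim_obj_def le_pairs_def by auto

lemma holim_arrD:
  assumes "holim_arr K le X R (x, \<phi>) (y, \<psi>) u"
  shows "I \<in> K \<Longrightarrow> u I \<in> hom (X I) (x I) (y I)"
    and "I \<in> K \<Longrightarrow> J \<in> K \<Longrightarrow> le I J \<Longrightarrow>
          Cmp (X J) (\<psi> (I, J)) (amap (R I J) (u I)) = Cmp (X J) (u J) (\<phi> (I, J))"
  using assms unfolding holim_arr_def le_pairs_def by auto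

lemma holim_arr_ext:
  "holim_arr K le X R p q u \<Longrightarrow> (\<And>I. I \<in> K \<Longrightarrow> f I = u I) \<Longrightarrow> (\<lambda>I \<in> K. f I) = u"
  unfolding holim_arr_def by (auto simp: PiE_def extensional_def restrict_def fun_eq_iff split: prod.splits)

lemma category_holim:
  assumes X: "\<And>I. I \<in> K \<Longrightarrow> category (X I)"
    and R: "\<And>I J. I \<in> K \<Longrightarrow> J \<in> K \<Longrightarrow> le I J \<Longrightarrow> is_functor (X I) (X J) (R I J)"
  shows "category (holim K le X R)"
proof -
  let ?H = "holim K le X R"
  have h: "(p, q, u) \<in> hom ?H p' q' \<longleftrightarrow> p = p' \<and> q = q' \<and>
     case_prod (holim_obj K le X R) p \<and> case_prod (holim_obj K le X R) q \<and> holim_arr K le X R p q u" for p q u p' q'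
    by (auto simp: hom_def holim_def)
  have hE: "\<exists>u. f = (p, q, u)" if "f \<in> hom ?H p q" for f p q
    using that by (auto simp: hom_def holim_def)
  show ?thesis
  proof
    fix f assume "f \<in> Arr ?H"
    then show "Dom ?H f \<in> Obj ?H" "Cod ?H f \<in> Obj ?H" by (auto simp: holim_def)
  next
    fix p assume p: "p \<in> Obj ?H"
    obtain x \<phi> where xp: "p = (x, \<phi>)" by fastforce
    then have o: "holim_obj K le X R x \<phi>" using p by (auto simp: holim_def)
    note D = holim_objD[OF o]
    have "holim_arr K le X R p p (\<lambda>I \<in> K. Idn (X I) (x I))"
      unfolding holim_arr_def xp le_pairs_def prod.case
    proof (intro conjI ballI)
      show "(\<lambda>I \<in> K. Idn (X I) (x I)) \<in> (\<Pi>\<^sub>E I \<in> K. hom (X I) (x I) (x I))"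
        using category.Idn_hom[OF X D(1)] by simp
    next
      fix z assume "z \<in> {(I, J). I \<in> K \<and> J \<in> K \<and> le I J}"
      then obtain I J where z: "z = (I, J)" and I: "I \<in> K" "J \<in> K" "le I J" by blast
      show "(case z of (I, J) \<Rightarrow> Cmp (X J) (\<phi> (I, J)) (amap (R I J) ((\<lambda>I \<in> K. Idn (X I) (x I)) I)) =
              Cmp (X J) ((\<lambda>I \<in> K. Idn (X I) (x I)) J) (\<phi> (I, J)))"
        using I is_functorD(3)[OF R[OF I] D(1)[OF I(1)]] category.Cmp_Idn_left[OF X[OF I(2)] D(2)[OF I]]
          category.Cmp_Idn_right[OF X[OF I(2)] D(2)[OF I]] by (simp add: z)
    qed
    then show "Idn ?H p \<in> hom ?H p p" using o xp by (simp add: holim_def hom_def)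
  next
    fix f g p q r
    assume f: "f \<in> hom ?H p q" and g: "g \<in> hom ?H q r"
    obtain u v where e: "f = (p, q, u)" "g = (q, r, v)" using hE[OF f] hE[OF g] by blast
    obtain x \<phi> y \<psi> z \<zeta> where xp: "p = (x, \<phi>)" "q = (y, \<psi>)" "r = (z, \<zeta>)" by (metis surj_pair)
    have o: "holim_obj K le X R x \<phi>" "holim_obj K le X R y \<psi>" "holim_obj K le X R z \<zeta>"
      and a: "holim_arr K le X R (x, \<phi>) (y, \<psi>) u" "holim_arr K le X R (y, \<psi>) (z, \<zeta>) v"
      using f g unfolding e h xp by simp_all
    have "Cmp (X J) (\<zeta> (I, J)) (amap (R I J) (Cmp (X I) (v I) (u I))) = Cmp (X J) (Cmp (X J) (v J) (u J)) (\<phi> (I, J))"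
      if I: "I \<in> K" "J \<in> K" "le I J" for I J
    proof -
      interpret J: category "X J" using X I by blast
      let ?R = "R I J"
      note F = is_functorD[OF R[OF I]]
      note uI = holim_arrD(1)[OF a(1) I(1)] and uJ = holim_arrD(1)[OF a(1) I(2)]
       and vI = holim_arrD(1)[OF a(2) I(1)] and vJ = holim_arrD(1)[OF a(2) I(2)]
      note p1 = holim_objD(2)[OF o(1) I] and p2 = holim_objD(2)[OF o(2) I] and p3 = holim_objD(2)[OF o(3) I]
      have Ru: "amap ?R (u I) \<in> hom (X J) (omap ?R (x I)) (omap ?R (y I))"
       and Rv: "amap ?R (v I) \<in> hom (X J) (omap ?R (y I)) (omap ?R (z I))"
        using F(2)[of "u I"] F(2)[of "v I"] uI vI by (auto simp: hom_def)
      have "amap ?R (Cmp (X I) (v I) (u I)) = Cmp (X J) (amap ?R (v I)) (amap ?R (u I))"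
        using F(4) uI vI by (auto simp: hom_def)
      then show ?thesis
        using J.Cmp_assoc[OF Ru Rv p3] J.Cmp_assoc[OF Ru p2 vJ] J.Cmp_assoc[OF p1 uJ vJ]
          holim_arrD(2)[OF a(1) I] holim_arrD(2)[OF a(2) I] by simp
    qed
    moreover have "Cmp (X I) (v I) (u I) \<in> hom (X I) (x I) (z I)" if "I \<in> K" for I
      using category.Cmp_hom[OF X[OF that] holim_arrD(1)[OF a(1) that] holim_arrD(1)[OF a(2) that]] .
    ultimately have "holim_arr K le X R p r (\<lambda>I \<in> K. Cmp (X I) (v I) (u I))"
      by (simp add: holim_arr_def xp le_pairs_def Ball_def split_paired_all)
    then show "Cmp ?H g f \<in> hom ?H p r" using o e xp by (simp add: holim_def hom_def)
  next
    fix f p q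
    assume f: "f \<in> hom ?H p q"
    obtain u where e: "f = (p, q, u)" using hE[OF f] by blast
    obtain x \<phi> y \<psi> where xp: "p = (x, \<phi>)" "q = (y, \<psi>)" by (metis surj_pair)
    have a: "holim_arr K le X R (x, \<phi>) (y, \<psi>) u" using f unfolding e h xp by simp
    have "(\<lambda>I \<in> K. Cmp (X I) ((\<lambda>I \<in> K. Idn (X I) (y I)) I) (u I)) = u"
      "(\<lambda>I \<in> K. Cmp (X I) (u I) ((\<lambda>I \<in> K. Idn (X I) (x I)) I)) = u"
      by (rule holim_arr_ext[OF a], simp add: category.Cmp_Idn_left[OF X holim_arrD(1)[OF a]]
            category.Cmp_Idn_right[OF X holim_arrD(1)[OF a]])+
    then show "Cmp ?H (Idn ?H q) f = f" "Cmp ?H f (Idn ?H p) = f"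
      unfolding e xp by (simp_all add: holim_def)
  next
    fix f g k p q r s
    assume f: "f \<in> hom ?H p q" and g: "g \<in> hom ?H q r" and k: "k \<in> hom ?H r s"
    obtain u v w where e: "f = (p, q, u)" "g = (q, r, v)" "k = (r, s, w)"
      using hE[OF f] hE[OF g] hE[OF k] by blast
    obtain x \<phi> y \<psi> z \<zeta> x' \<phi>' where xp: "p = (x, \<phi>)" "q = (y, \<psi>)" "r = (z, \<zeta>)" "s = (x', \<phi>')" by (metis surj_pair)
    have a: "holim_arr K le X R (x, \<phi>) (y, \<psi>) u" "holim_arr K le X R (y, \<psi>) (z, \<zeta>) v" "holim_arr K le X R (z, \<zeta>) (x', \<phi>') w"
      using f g k unfolding e h xp by simp_all
    show "Cmp ?H k (Cmp ?H g f) = Cmp ?H (Cmp ?H k g) f"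
      unfolding e using category.Cmp_assoc[OF X holim_arrD(1)[OF a(1)] holim_arrD(1)[OF a(2)] holim_arrD(1)[OF a(3)]]
      by (simp add: holim_def cong: restrict_cong)
  qed
qed

lemma is_iso_Idn: "category C \<Longrightarrow> a \<in> Obj C \<Longrightarrow> is_iso C (Idn C a)"
  unfolding is_iso_def
  using category.Idn_hom category.Cmp_Idn_left[of C "Idn C a" a a] by (fastforce simp: hom_def)

lemma is_functor_two_segal_map:
  fixes X :: "nat set \<Rightarrow> ('o, 'm) cat"
  assumes sub: "\<And>t. t \<in> \<Delta> \<Longrightarrow> t \<subseteq> {0..n}"
    and X: "\<And>I. I \<subseteq> {0..n} \<Longrightarrow> category (X I)"
    and R: "\<And>I J. I \<subseteq> J \<Longrightarrow> J \<subseteq> {0..n} \<Longrightarrow> is_functor (X J) (X I) (R J I)"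
    and R_id: "\<And>I. I \<subseteq> {0..n} \<Longrightarrow> R I I = id_fctr (X I)"
    and R_comp: "\<And>I J L. I \<subseteq> J \<Longrightarrow> J \<subseteq> L \<Longrightarrow> L \<subseteq> {0..n} \<Longrightarrow> comp_fctr (X L) (R J I) (R L J) = R L I"
  shows "is_functor (X {0..n}) (two_segal_target X R n \<Delta>) (two_segal_map X R n \<Delta>)"
proof -
  let ?N = "{0..n}"
  let ?le = "\<lambda>I J :: nat set. J \<subseteq> I"
  define K where "K = \<Delta> \<union> diagonals n \<Delta>"
  define F where "F = (\<lambda>x. (\<lambda>I \<in> K. omap (R ?N I) x, \<lambda>(I, J) \<in> le_pairs K ?le. Idn (X J) (omap (R ?N J) x)))"
  have K: "I \<subseteq> ?N" if "I \<in> K" for I using that sub by (auto simp: K_def diagonals_def)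
  interpret N: category "X ?N" using X by blast
  note Rf = is_functorD[OF R[OF K order_refl]]
  have Ro: "omap (R J I) (omap (R ?N J) x) = omap (R ?N I) x" if "I \<subseteq> J" "J \<in> K" "x \<in> Obj (X ?N)" for I J x
    using R_comp[OF that(1) K[OF that(2)]] that(3) by (auto simp: comp_fctr_def fun_eq_iff dest!: arg_cong[where f=omap])
       (metis restrict_apply')
  have Ra: "amap (R J I) (amap (R ?N J) f) = amap (R ?N I) f" if "I \<subseteq> J" "J \<in> K" "f \<in> Arr (X ?N)" for I J f
    using R_comp[OF that(1) K[OF that(2)]] that(3) by (auto simp: comp_fctr_def fun_eq_iff dest!: arg_cong[where f=amap])
       (metis restrict_apply')
  have o: "case_prod (holim_obj K ?le X R) (F x)" if x: "x \<in> Obj (X ?N)" for x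
  proof -
    have ob: "omap (R ?N I) x \<in> Obj (X I)" if "I \<in> K" for I using Rf(1)[OF that] x by blast
    have 1: "Idn (X L) (omap (R ?N L) x) = Cmp (X L) (Idn (X L) (omap (R ?N L) x)) (amap (R J L) (Idn (X J) (omap (R ?N J) x)))"
      if "L \<subseteq> J" "L \<in> K" "J \<in> K" for L J
      using is_functorD(3)[OF R[OF that(1) K[OF that(3)]] ob[OF that(3)]] Ro[OF that(1,3) x]
        category.Idn_hom[OF X[OF K] ob, OF that(2,2)] category.Cmp_Idn_left[OF X[OF K], OF that(2)] by metis
    show ?thesis
      using 1 ob Ro[OF _ _ x] category.Idn_hom[OF X[OF K] ob] is_iso_Idn[OF X[OF K] ob]
      by (auto simp: F_def holim_obj_def le_pairs_def)
  qed
  have a: "holim_arr K ?le X R (F (Dom (X ?N) f)) (F (Cod (X ?N) f)) (\<lambda>I \<in> K. amap (R ?N I) f)" if f: "f \<in> Arr (X ?N)" for f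
  proof -
    have "Cmp (X J) (Idn (X J) (omap (R ?N J) (Cod (X ?N) f))) (amap (R ?N J) f) = Cmp (X J) (amap (R ?N J) f) (Idn (X J) (omap (R ?N J) (Dom (X ?N) f)))"
      if J: "J \<in> K" for J
      using category.Cmp_Idn_left[OF X[OF K[OF J]] Rf(2)[OF J f]] category.Cmp_Idn_right[OF X[OF K[OF J]] Rf(2)[OF J f]] by simp
    then show ?thesis using Rf(2)[OF _ f] Ra[OF _ _ f] by (auto simp: holim_arr_def F_def le_pairs_def)
  qed
  have m: "two_segal_map X R n \<Delta> = \<lparr>omap = (\<lambda>x \<in> Obj (X ?N). F x), amap = (\<lambda>f \<in> Arr (X ?N). (F (Dom (X ?N) f), F (Cod (X ?N) f), \<lambda>I \<in> K. amap (R ?N I) f))\<rparr>"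
    unfolding two_segal_map_def K_def F_def Let_def ..
  have i: "Idn (X ?N) x \<in> Arr (X ?N)" "Dom (X ?N) (Idn (X ?N) x) = x" "Cod (X ?N) (Idn (X ?N) x) = x" if "x \<in> Obj (X ?N)" for x
    using N.Idn_hom[OF that] by (auto simp: hom_def)
  have c: "Cmp (X ?N) g f \<in> Arr (X ?N)" "Dom (X ?N) (Cmp (X ?N) g f) = Dom (X ?N) f" "Cod (X ?N) (Cmp (X ?N) g f) = Cod (X ?N) g"
    if "f \<in> Arr (X ?N)" "g \<in> Arr (X ?N)" "Cod (X ?N) f = Dom (X ?N) g" for f g
    using N.Cmp_hom[of f "Dom (X ?N) f" "Cod (X ?N) f" g "Cod (X ?N) g"] that by (auto simp: hom_def)
  show ?thesis
    unfolding is_functor_def m two_segal_target_def K_def[symmetric]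
    using o a N.Dom_Obj N.Cod_Obj i c Rf(3) Rf(4)
    by (auto simp: holim_def hom_def F_def intro!: restrict_ext)
qed

lemma category_two_segal_target_Sdot:
  assumes C: "category_with_cofibrations C" and T: "polygon_triangulation n \<Delta>"
  shows "category (two_segal_target (Sdot C) (Sdot_res C) n \<Delta>)"
  unfolding two_segal_target_def
  using C by (intro category_holim category_Sdot is_functor_Sdot_map)
     (auto simp: category_with_cofibrations_def mono_on_def)

lemma is_functor_two_segal_map_Sdot:
  assumes C: "category_with_cofibrations C" and T: "polygon_triangulation n \<Delta>"
  shows "is_functor (Sdot C {0..n}) (two_segal_target (Sdot C) (Sdot_res C) n \<Delta>)
           (two_segal_map (Sdot C) (Sdot_res C) n \<Delta>)"
proof (rule is_functor_two_segal_map)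
  show "category (Sdot C I)" for I using C category_Sdot by (auto simp: category_with_cofibrations_def)
  show "t \<subseteq> {0..n}" if "t \<in> \<Delta>" for t using T that by (auto simp: polygon_triangulation_def)
  show "is_functor (Sdot C J) (Sdot C I) (Sdot_res C J I)" if "I \<subseteq> J" for I J
    using that by (intro is_functor_Sdot_map[OF C]) (auto simp: mono_on_def)
  show "Sdot_res C I I = id_fctr (Sdot C I)" for I by (rule Sdot_map_id[OF C])
  show "comp_fctr (Sdot C L) (Sdot_res C J I) (Sdot_res C L J) = Sdot_res C L I" if "I \<subseteq> J" "J \<subseteq> L" for I J L
    using Sdot_map_comp[OF C, of I "\<lambda>i. i" J "\<lambda>i. i" L] that by (simp add: mono_on_def o_def)
qed

end

theory Submission
  imports Defs
begin

text \<open>If a triangle \<open>{p < q < r}\<close> avoids \<open>0\<close>, then some vertex \<open>j\<close> (namely \<open>q\<close>) is not joined to \<open>0\<close> by an edge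
  of the triangulation, so the entry \<open>A\<^sub>0\<^sub>j\<close> of a simplex is not an entry of any of its restrictions to
  triangles and diagonals. In the category of finite pointed sets, declare the maps that are injective
  away from the preimage of the base point to be cofibrations. Then \<open>V \<rightarrow> 0\<close> is a cofibration with cokernel
  \<open>0\<close>, and the chains \<open>V = \<dots> = V \<rightarrow> 0 \<rightarrow> \<dots> \<rightarrow> 0\<close> with \<open>A\<^sub>0\<^sub>j = V\<close> resp. \<open>A\<^sub>0\<^sub>j = 0\<close> as the only
  difference define non-isomorphic simplices with the same image under the 2-Segal map.\<close>

section \<open>Finite pointed sets\<close>

text \<open>A number \<open>a\<close> codes the pointed set \<open>set_decode a\<close> with a base point added. A pointed map is given
  by the graph of a partial map, which is undefined where the pointed map takes the base point as value;
  cofibrations are then the partial injections.\<close>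

definition pmap :: "nat \<Rightarrow> nat \<Rightarrow> (nat \<times> nat) set \<Rightarrow> nat" where
  "pmap a b G = prod_encode (a, prod_encode (b, set_encode (prod_encode ` G)))"

definition src :: "nat \<Rightarrow> nat" where
  "src m = fst (prod_decode m)"

definition tgt :: "nat \<Rightarrow> nat" where
  "tgt m = fst (prod_decode (snd (prod_decode m)))"

definition graph :: "nat \<Rightarrow> (nat \<times> nat) set" where
  "graph m = prod_decode ` set_decode (snd (prod_decode (snd (prod_decode m))))"

lemma pmap_sel [simp]:
  "src (pmap a b G) = a" "tgt (pmap a b G) = b" "finite G \<Longrightarrow> graph (pmap a b G) = G"
  by (simp_all add: pmap_def src_def tgt_def graph_def image_comp)

lemma finite_graph [simp]: "finite (graph m)"
  by (simp add: graph_def)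

lemma pmap_collapse [simp]: "pmap (src m) (tgt m) (graph m) = m"
  by (simp add: pmap_def src_def tgt_def graph_def image_comp)

lemma pmap_eqI: "src f = src g \<Longrightarrow> tgt f = tgt g \<Longrightarrow> graph f = graph g \<Longrightarrow> f = g"
  by (metis pmap_collapse)

definition is_pmap :: "nat \<Rightarrow> nat \<Rightarrow> (nat \<times> nat) set \<Rightarrow> bool" where
  "is_pmap a b G \<longleftrightarrow> G \<subseteq> set_decode a \<times> set_decode b \<and> single_valued G"

lemma is_pmap_finite: "is_pmap a b G \<Longrightarrow> finite G"
  unfolding is_pmap_def by (meson finite_SigmaI finite_set_decode finite_subset)

lemma is_pmap_comp: "is_pmap a b F \<Longrightarrow> is_pmap b c G \<Longrightarrow> is_pmap a c (F O G)"
  unfolding is_pmap_def by (auto simp: single_valued_relcomp)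

text \<open>Every number is an object, since \<open>set_decode\<close> maps onto the finite sets of
  numbers. The number \<open>0\<close> decodes to the empty set, leaving only the base point, so it
  is the zero object. \<open>O\<close> composes in diagrammatic order, opposite to
  \<open>Cmp\<close>.\<close>

definition Fin_pt :: "(nat, nat) cof_cat" where
  "Fin_pt = \<lparr>Obj = UNIV, Arr = {f. is_pmap (src f) (tgt f) (graph f)}, Dom = src, Cod = tgt,
     Idn = (\<lambda>a. pmap a a (Id_on (set_decode a))),
     Cmp = (\<lambda>g f. pmap (src f) (tgt g) (graph f O graph g)),
     Zero = 0,
     Cof = {f. is_pmap (src f) (tgt f) (graph f) \<and> single_valued ((graph f)\<inverse>)}\<rparr>"

lemma Fin_pt_sel [simp]:
  "Obj Fin_pt = UNIV" "Dom Fin_pt = src" "Cod Fin_pt = tgt" "Zero Fin_pt = 0"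
  "Idn Fin_pt a = pmap a a (Id_on (set_decode a))"
  by (simp_all add: Fin_pt_def)

lemma Arr_Fin_pt: "f \<in> Arr Fin_pt \<longleftrightarrow> is_pmap (src f) (tgt f) (graph f)"
  by (simp add: Fin_pt_def)

lemma Cof_Fin_pt: "f \<in> Cof Fin_pt \<longleftrightarrow> f \<in> Arr Fin_pt \<and> single_valued ((graph f)\<inverse>)"
  by (simp add: Fin_pt_def)

lemma hom_Fin_pt: "f \<in> hom Fin_pt a b \<longleftrightarrow> src f = a \<and> tgt f = b \<and> is_pmap a b (graph f)"
  by (auto simp: hom_def Arr_Fin_pt)

lemma Cmp_sel [simp]:
  "src (Cmp Fin_pt g f) = src f" "tgt (Cmp Fin_pt g f) = tgt g"
  "graph (Cmp Fin_pt g f) = graph f O graph g"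
  by (simp_all add: Fin_pt_def)

lemma Cmp_eq_iff:
  "Cmp Fin_pt g f = k \<longleftrightarrow> src f = src k \<and> tgt g = tgt k \<and> graph f O graph g = graph k"
  by (metis Cmp_sel pmap_eqI)

lemma finite_Id_on [simp]: "finite A \<Longrightarrow> finite (Id_on A)"
  by (simp add: Id_on_def)

lemma category_Fin_pt: "category Fin_pt"
proof
  show "Idn Fin_pt a \<in> hom Fin_pt a a" for a
    by (auto simp: hom_Fin_pt is_pmap_def)
  show "Cmp Fin_pt (Idn Fin_pt b) f = f" "Cmp Fin_pt f (Idn Fin_pt a) = f"
    if "f \<in> hom Fin_pt a b" for f a b
    using that by (auto simp: hom_Fin_pt is_pmap_def Cmp_eq_iff)
qed (auto simp: hom_Fin_pt is_pmap_comp O_assoc Cmp_eq_iff Arr_Fin_pt)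

text \<open>If \<open>g\<close> is inverse to \<open>f\<close>, then
  \<open>graph f O graph g\<close> is an identity relation, so the converse of
  \<open>graph f\<close> lies in \<open>graph g\<close>, which is single-valued.\<close>

lemma Cof_iso_Fin_pt:
  assumes "is_iso Fin_pt f"
  shows "f \<in> Cof Fin_pt"
proof -
  obtain g where g: "g \<in> hom Fin_pt (tgt f) (src f)"
      "Cmp Fin_pt g f = pmap (src f) (src f) (Id_on (set_decode (src f)))"
    and f: "f \<in> Arr Fin_pt"
    using assms by (auto simp: is_iso_def)
  have FG: "graph f O graph g = Id_on (set_decode (src f))"
    using arg_cong[OF g(2), of graph] by simp
  have sub: "graph f \<subseteq> set_decode (src f) \<times> set_decode (tgt f)" and sv: "single_valued (graph f)"
      "single_valued (graph g)"
    using f g by (auto simp: Arr_Fin_pt hom_Fin_pt is_pmap_def)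
  have "(b, a) \<in> graph g" if "(a, b) \<in> graph f" for a b
  proof -
    have "(a, a) \<in> graph f O graph g"
      using that sub FG by auto
    then show ?thesis using that sv(1) unfolding single_valued_def by blast
  qed
  then have "single_valued ((graph f)\<inverse>)"
    using sv(2) unfolding single_valued_def by blast
  then show ?thesis using f by (simp add: Cof_Fin_pt)
qed

section \<open>Pushouts along partial injections\<close>

lemma is_pushout_Fin_ptI:
  assumes "f \<in> Arr Fin_pt" "g \<in> Arr Fin_pt" "src g = src f"
    and "h \<in> hom Fin_pt (tgt f) d" "k \<in> hom Fin_pt (tgt g) d"
    and "graph f O graph h = graph g O graph k"
    and "\<And>z U V. \<lbrakk>is_pmap (tgt f) z U; is_pmap (tgt g) z V; graph f O U = graph g O V\<rbrakk> \<Longrightarrow>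
           \<exists>W. is_pmap d z W \<and> graph h O W = U \<and> graph k O W = V"
    and epi: "set_decode d \<subseteq> Range (graph h) \<union> Range (graph k)"
  shows "is_pushout Fin_pt f g h k"
proof -
  have up: "\<exists>!w. w \<in> hom Fin_pt d z \<and> Cmp Fin_pt w h = u \<and> Cmp Fin_pt w k = v"
    if u: "u \<in> hom Fin_pt (tgt f) z" and v: "v \<in> hom Fin_pt (tgt g) z"
      and e: "Cmp Fin_pt u f = Cmp Fin_pt v g" for z u v
  proof -
    have "graph f O graph u = graph g O graph v"
      using arg_cong[OF e, of graph] by simp
    then obtain W where W: "is_pmap d z W" "graph h O W = graph u" "graph k O W = graph v"
      using assms(7)[of z "graph u" "graph v"] u v unfolding hom_Fin_pt by blast
    show ?thesis
    proof (rule ex1I[of _ "pmap d z W"])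
      show "pmap d z W \<in> hom Fin_pt d z \<and> Cmp Fin_pt (pmap d z W) h = u \<and> Cmp Fin_pt (pmap d z W) k = v"
        using W u v assms(4,5) is_pmap_finite[OF W(1)] by (simp add: hom_Fin_pt Cmp_eq_iff)
    next
      fix w assume w: "w \<in> hom Fin_pt d z \<and> Cmp Fin_pt w h = u \<and> Cmp Fin_pt w k = v"
      then have eq: "graph h O graph w = graph h O W" "graph k O graph w = graph k O W"
        using W Cmp_sel(3) by metis+
      \<comment> \<open>Uniqueness follows from joint surjectivity: \<open>x\<close> has a preimage
        \<open>b\<close> under \<open>h\<close> or \<open>k\<close>, and the composite at
        \<open>b\<close> determines the map at \<open>x\<close>.\<close>
      have "(x, y) \<in> graph w \<longleftrightarrow> (x, y) \<in> W" if "x \<in> set_decode d" for x y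
      proof -
        have sv: "single_valued (graph h)" "single_valued (graph k)"
          using assms(4,5) by (auto simp: hom_Fin_pt is_pmap_def)
        consider b where "(b, x) \<in> graph h" | b where "(b, x) \<in> graph k" using epi \<open>x \<in> set_decode d\<close> by blast
        then show ?thesis
        proof cases
          case 1
          with sv(1) have "(b, y) \<in> graph h O T \<longleftrightarrow> (x, y) \<in> T" for T
            unfolding single_valued_def by blast
          then show ?thesis using eq(1) by metis
        next
          case 2
          with sv(2) have "(b, y) \<in> graph k O T \<longleftrightarrow> (x, y) \<in> T" for T
            unfolding single_valued_def by blast
          then show ?thesis using eq(2) by metis
        qed
      qed
      then have "graph w = W"
        using w W(1) unfolding hom_Fin_pt is_pmap_def by blast
      then show "w = pmap d z W"
        using w unfolding hom_Fin_pt by (metis pmap_collapse)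
    qed
  qed
  have hk: "src h = tgt f" "tgt h = d" "src k = tgt g" "tgt k = d" "h \<in> Arr Fin_pt" "k \<in> Arr Fin_pt"
    using assms(4,5) by (auto simp: hom_Fin_pt Arr_Fin_pt)
  then have "Cmp Fin_pt h f = Cmp Fin_pt k g"
    using assms(3,6) by (simp add: Cmp_eq_iff)
  then show ?thesis
    using assms(1-3) hk up by (simp add: is_pushout_def)
qed

text \<open>The pushout of \<open>f\<close> along \<open>g : A \<rightarrow> E\<close> adds to \<open>E\<close> (even numbers) the elements of \<open>B\<close> that \<open>f\<close>
  misses (odd numbers) and collapses the elements \<open>g a\<close> for which \<open>f a\<close> is the base point.\<close>

lemma pushout_Fin_pt:
  assumes f: "f \<in> Cof Fin_pt" and g: "g \<in> Arr Fin_pt" and fg: "src g = src f"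
  obtains h k where "is_pushout Fin_pt f g h k"
    "graph k = (\<lambda>e. (e, 2 * e)) ` (set_decode (tgt g) - graph g `` (set_decode (src f) - Domain (graph f)))"
proof -
  let ?F = "graph f" and ?G = "graph g"
  define E where "E = set_decode (tgt g) - ?G `` (set_decode (src f) - Domain ?F)"
  define B where "B = set_decode (tgt f) - Range ?F"
  define d where "d = set_encode ((\<lambda>e. 2 * e) ` E \<union> (\<lambda>b. 2 * b + 1) ` B)"
  define H where "H = {(b, 2 * e) | a b e. (a, b) \<in> ?F \<and> (a, e) \<in> ?G \<and> e \<in> E} \<union> (\<lambda>b. (b, 2 * b + 1)) ` B"
  define K where "K = (\<lambda>e. (e, 2 * e)) ` E"
  have fin: "finite E" "finite B" by (simp_all add: E_def B_def)
  then have d: "set_decode d = (\<lambda>e. 2 * e) ` E \<union> (\<lambda>b. 2 * b + 1) ` B" by (simp add: d_def)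
  have F: "?F \<subseteq> set_decode (src f) \<times> set_decode (tgt f)" "single_valued ?F" "single_valued (?F\<inverse>)"
    and G: "?G \<subseteq> set_decode (src f) \<times> set_decode (tgt g)" "single_valued ?G"
    using f g fg by (auto simp: Cof_Fin_pt Arr_Fin_pt is_pmap_def)
  have H: "is_pmap (tgt f) d H"
    unfolding is_pmap_def
  proof
    show "H \<subseteq> set_decode (tgt f) \<times> set_decode d"
      using F(1) by (auto simp: H_def B_def d)
    \<comment> \<open>Since \<open>f\<close> is a partial injection, the point that \<open>b\<close>
      is glued to does not depend on the choice of \<open>a\<close>.\<close>
    have "e = e'" if "(a, b) \<in> ?F" "(a, e) \<in> ?G" "(a', b) \<in> ?F" "(a', e') \<in> ?G" for a a' b e e'
      using that F(3) G(2) unfolding single_valued_def by blast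
    then show "single_valued H"
      by (auto simp: single_valued_def H_def B_def)
  qed
  have K: "is_pmap (tgt g) d K"
    unfolding is_pmap_def K_def d single_valued_def by (auto simp: E_def)
  have sq: "?F O H = ?G O K"
  proof (intro subset_antisym subrelI)
    show "(x, y) \<in> ?G O K" if xy: "(x, y) \<in> ?F O H" for x y
    proof -
      obtain b where b: "(x, b) \<in> ?F" "(b, y) \<in> H"
        using xy by blast
      then obtain a e where "(a, b) \<in> ?F" "(a, e) \<in> ?G" "e \<in> E" "y = 2 * e"
        unfolding H_def B_def by blast
      then have "(x, e) \<in> ?G" "(e, y) \<in> K"
        using F(3) b(1) unfolding K_def single_valued_def by blast+
      then show ?thesis by blast
    qed
    show "(x, y) \<in> ?F O H" if xy: "(x, y) \<in> ?G O K" for x y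
    proof -
      obtain e where e: "(x, e) \<in> ?G" "e \<in> E" "y = 2 * e"
        using xy by (auto simp: K_def)
      then obtain b where "(x, b) \<in> ?F"
        using G(1) by (auto simp: E_def)
      then show ?thesis using e by (auto simp: H_def)
    qed
  qed
  have "is_pushout Fin_pt f g (pmap (tgt f) d H) (pmap (tgt g) d K)"
  proof (rule is_pushout_Fin_ptI[where d = d])
    fix z U V
    assume U: "is_pmap (tgt f) z U" and V: "is_pmap (tgt g) z V" and UV: "?F O U = ?G O V"
    \<comment> \<open>The induced map is \<open>V\<close> on the even part and \<open>U\<close> on
      the odd part. On elements of \<open>B\<close> that are glued to \<open>E\<close>, fact
      \<open>1\<close> shows that it agrees with \<open>U\<close>.\<close>
    define W where "W = {(2 * e, y) | e y. e \<in> E \<and> (e, y) \<in> V} \<union> {(2 * b + 1, y) | b y. b \<in> B \<and> (b, y) \<in> U}"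
    have 1: "(b, y) \<in> U \<longleftrightarrow> (e, y) \<in> V" if "(a, b) \<in> ?F" "(a, e) \<in> ?G" for a b e y
    proof -
      have "(b, y) \<in> U \<longleftrightarrow> (a, y) \<in> ?F O U" "(e, y) \<in> V \<longleftrightarrow> (a, y) \<in> ?G O V"
        using that F(2) G(2) unfolding single_valued_def by blast+
      then show ?thesis using UV by simp
    qed
    \<comment> \<open>\<open>V\<close> sends the collapsed elements to the base point: if
      \<open>f a\<close> is the base point, commutativity forces this at \<open>g a\<close>.\<close>
    have 2: "e \<in> E" if "(e, y) \<in> V" for e y
    proof -
      have "a \<in> Domain ?F" if "(a, e) \<in> ?G" for a
        using that \<open>(e, y) \<in> V\<close> UV by (metis DomainI relcomp.cases relcompI)
      then show ?thesis using that V by (auto simp: E_def is_pmap_def)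
    qed
    have 3: "\<exists>e. (a, e) \<in> ?G \<and> (e, y) \<in> V" if "(a, b) \<in> ?F" "(b, y) \<in> U" for a b y
      using that UV by blast
    have "is_pmap d z W"
    proof -
      have "W \<subseteq> set_decode d \<times> set_decode z"
        using U V by (auto simp: is_pmap_def W_def d)
      moreover have "single_valued W"
        using U V by (auto simp: is_pmap_def W_def single_valued_def; simp add: double_not_eq_Suc_double Suc_double_not_eq_double)
      ultimately show ?thesis by (simp add: is_pmap_def)
    qed
    moreover have "H O W = U"
    proof -
      have "(x, y) \<in> H O W \<longleftrightarrow> (x, y) \<in> U" for x y
      proof
        show "(x, y) \<in> U" if xy: "(x, y) \<in> H O W"
        proof -
          obtain w where "(x, w) \<in> H" "(w, y) \<in> W" using xy by blast
          then consider a e where "(a, x) \<in> ?F" "(a, e) \<in> ?G" "(e, y) \<in> V" | "(x, y) \<in> U"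
            by (auto simp: H_def W_def double_not_eq_Suc_double Suc_double_not_eq_double)
          then show ?thesis by cases (simp_all add: 1)
        qed
        show "(x, y) \<in> H O W" if xy: "(x, y) \<in> U"
        proof (cases "x \<in> Range ?F")
          case True
          then obtain a e where "(a, x) \<in> ?F" "(a, e) \<in> ?G" "(e, y) \<in> V" using 3 xy by blast
          then have "(x, 2 * e) \<in> H" "(2 * e, y) \<in> W" using 2 by (auto simp: H_def W_def)
          then show ?thesis by blast
        next
          case False
          then have "x \<in> B" using xy U by (auto simp: B_def is_pmap_def)
          then have "(x, 2 * x + 1) \<in> H" "(2 * x + 1, y) \<in> W" using xy by (auto simp: H_def W_def)
          then show ?thesis by blast
        qed
      qed
      then show ?thesis by auto
    qed
    moreover have "K O W = V"
    proof (intro subset_antisym subrelI)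
      show "(x, y) \<in> V" if "(x, y) \<in> K O W" for x y
        using that by (auto simp: K_def W_def double_not_eq_Suc_double)
      show "(x, y) \<in> K O W" if "(x, y) \<in> V" for x y
        using 2[OF that] that by (auto simp: K_def W_def)
    qed
    ultimately show "\<exists>W. is_pmap d z W \<and> graph (pmap (tgt f) d H) O W = U \<and> graph (pmap (tgt g) d K) O W = V"
      using is_pmap_finite[OF H] is_pmap_finite[OF K] by auto
  next
    show "set_decode d \<subseteq> Range (graph (pmap (tgt f) d H)) \<union> Range (graph (pmap (tgt g) d K))"
      using is_pmap_finite[OF H] is_pmap_finite[OF K] by (auto simp: d H_def K_def)
  qed (use f g fg H K sq is_pmap_finite[OF H] is_pmap_finite[OF K] in \<open>auto simp: Cof_Fin_pt hom_Fin_pt\<close>)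
  then show ?thesis
    using that[of "pmap (tgt f) d H" "pmap (tgt g) d K"] is_pmap_finite[OF K] by (simp add: K_def E_def)
qed

text \<open>The map \<open>k'\<close> of the pushout constructed above factors as \<open>w\<close>
  after \<open>k\<close>. By commutativity \<open>k\<close> is undefined on the collapsed elements,
  and on all others \<open>k'\<close> is defined and injective, so \<open>k\<close> is injective
  where it is defined.\<close>

lemma Cof_pushout_Fin_pt:
  assumes f: "f \<in> Cof Fin_pt" and po: "is_pushout Fin_pt f g h k"
  shows "k \<in> Cof Fin_pt"
proof -
  have g: "g \<in> Arr Fin_pt" "src g = src f" and k: "k \<in> Arr Fin_pt" "src k = tgt g"
    and sq: "Cmp Fin_pt h f = Cmp Fin_pt k g"
    using po by (auto simp: is_pushout_def)
  obtain h' k' where po': "is_pushout Fin_pt f g h' k'" and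
    k': "graph k' = (\<lambda>e. (e, 2 * e)) ` (set_decode (tgt g) - graph g `` (set_decode (src f) - Domain (graph f)))"
    using pushout_Fin_pt[OF f g] .
  obtain w where "Cmp Fin_pt w k = k'"
    using po po' by (auto simp: is_pushout_def hom_def) metis
  then have w: "graph k O graph w = graph k'" by auto
  have sq: "graph f O graph h = graph g O graph k"
    using arg_cong[OF sq, of graph] by simp
  have sv: "single_valued (graph k)" and sub: "graph k \<subseteq> set_decode (tgt g) \<times> set_decode (tgt k)"
    using k by (auto simp: Arr_Fin_pt is_pmap_def)
  have 1: "(y, 2 * x) \<in> graph w" if "(x, y) \<in> graph k" for x y
  proof -
    have "x \<notin> graph g `` (set_decode (src f) - Domain (graph f))"
      using that sq by blast
    then have "(x, 2 * x) \<in> graph k'" using that sub by (auto simp: k')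
    then obtain y' where "(x, y') \<in> graph k" "(y', 2 * x) \<in> graph w" using w by blast
    then show ?thesis using that sv by (auto simp: single_valued_def)
  qed
  have "x = x'" if "(x, y) \<in> graph k" "(x', y) \<in> graph k" for x x' y
  proof -
    have "(x, 2 * x') \<in> graph k O graph w" using that 1 by blast
    then show ?thesis by (auto simp: w k')
  qed
  then show ?thesis using k by (auto simp: Cof_Fin_pt single_valued_def)
qed

lemma category_with_cofibrations_Fin_pt: "category_with_cofibrations Fin_pt"
proof -
  interpret category Fin_pt by (rule category_Fin_pt)
  have z: "is_pmap 0 a G \<longleftrightarrow> G = {}" "is_pmap a 0 G \<longleftrightarrow> G = {}" for a G
    by (auto simp: is_pmap_def)
  show ?thesis
  proof
    show "\<exists>!f. f \<in> hom Fin_pt (Zero Fin_pt) a" for a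
      by (rule ex1I[of _ "pmap 0 a {}"]) (auto simp: hom_Fin_pt z, metis pmap_collapse)
    show "\<exists>!f. f \<in> hom Fin_pt a (Zero Fin_pt)" for a
      by (rule ex1I[of _ "pmap a 0 {}"]) (auto simp: hom_Fin_pt z, metis pmap_collapse)
    show "f \<in> Cof Fin_pt" if "f \<in> hom Fin_pt (Zero Fin_pt) a" for a f
      using that by (auto simp: hom_Fin_pt z Cof_Fin_pt Arr_Fin_pt)
    show "Cmp Fin_pt g f \<in> Cof Fin_pt" if "f \<in> Cof Fin_pt" "g \<in> Cof Fin_pt" "Cod Fin_pt f = Dom Fin_pt g" for f g
      using that by (auto simp: Cof_Fin_pt Arr_Fin_pt converse_relcomp single_valued_relcomp is_pmap_comp)
    show "\<exists>h k. is_pushout Fin_pt f g h k"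
      if "f \<in> Cof Fin_pt" "g \<in> Arr Fin_pt" "Dom Fin_pt g = Dom Fin_pt f" for f g
      using that pushout_Fin_pt[of f g] by (metis Fin_pt_sel(2))
    show "f \<in> Cof Fin_pt" if "is_iso Fin_pt f" for f by (rule Cof_iso_Fin_pt[OF that])
    show "k \<in> Cof Fin_pt" if "f \<in> Cof Fin_pt" "is_pushout Fin_pt f g h k" for f g h k
      by (rule Cof_pushout_Fin_pt[OF that])
  qed (auto simp: Cof_Fin_pt)
qed


section \<open>Two simplices with equal restrictions\<close>

text \<open>Row \<open>a = 0\<close> is the chain itself, and \<open>0 < b\<close> keeps its
  diagonal entry zero. Rows \<open>a > 0\<close> hold the quotients: the cokernels of
  \<open>V = V\<close>, of \<open>V -> 0\<close> and of \<open>0 = 0\<close> are all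
  \<open>0\<close>.\<close>

definition edge_val :: "nat \<Rightarrow> ar \<Rightarrow> nat" where
  "edge_val j = (\<lambda>(a, b). if a = 0 \<and> 0 < b \<and> b \<le> j then 1 else 0)"

text \<open>The simplex determined by the chain \<open>V = \<dots> = V \<rightarrow> 0 \<rightarrow> \<dots> \<rightarrow> 0\<close>, in which the \<open>j\<close> objects
  \<open>V\<close> are the pointed set with two elements, coded by \<open>1\<close>. All quotients vanish.\<close>

definition edge_simplex :: "nat \<Rightarrow> nat \<Rightarrow> (nat, nat) Sobj" where
  "edge_simplex n j =
     \<lparr>omap = (\<lambda>x \<in> Obj (Ar {0..n}). edge_val j x),
      amap = (\<lambda>(x, y) \<in> Arr (Ar {0..n}). pmap (edge_val j x) (edge_val j y)
                (Id_on (set_decode (edge_val j x) \<inter> set_decode (edge_val j y))))\<rparr>"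

lemma set_decode_one: "set_decode (Suc 0) = {0}"
  using set_encode_inverse[of "{0}"] by (simp add: set_encode_def)

lemma set_decode_edge_val: "set_decode (edge_val j x) = {i. i = 0 \<and> edge_val j x = 1}"
  by (auto simp: edge_val_def set_decode_one split: prod.splits)


lemma edge_simplex_sel:
  "x \<in> Obj (Ar {0..n}) \<Longrightarrow> omap (edge_simplex n j) x = edge_val j x"
  "(x, y) \<in> Arr (Ar {0..n}) \<Longrightarrow> amap (edge_simplex n j) (x, y) =
     pmap (edge_val j x) (edge_val j y) (Id_on (set_decode (edge_val j x) \<inter> set_decode (edge_val j y)))"
  by (simp_all add: edge_simplex_def)

lemma Id_on_relcomp: "Id_on A O Id_on B = Id_on (A \<inter> B)"
  by auto

lemma is_functor_edge_simplex: "is_functor (Ar {0..n}) Fin_pt (edge_simplex n j)"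
proof -
  let ?X = "edge_simplex n j" and ?v = "\<lambda>x. set_decode (edge_val j x)"
  interpret A: category "Ar {0..n}" by (rule category_Ar)
  have pm: "is_pmap (edge_val j x) (edge_val j y) (Id_on (?v x \<inter> ?v y))" for x y
    by (auto simp: is_pmap_def single_valued_def)
  \<comment> \<open>Between two comparable entries equal to \<open>V\<close> every entry is
    \<open>V\<close>. Hence no identity of \<open>V\<close> is lost by composing through an
    intermediate entry.\<close>
  have tr: "?v x \<inter> ?v z \<subseteq> ?v y"
    if "(x, y) \<in> Arr (Ar {0..n})" "(y, z) \<in> Arr (Ar {0..n})" for x y z
    using that by (auto simp: set_decode_edge_val edge_val_def Ar_simps split: if_splits)
  have hom: "amap ?X f \<in> hom Fin_pt (omap ?X (Dom (Ar {0..n}) f)) (omap ?X (Cod (Ar {0..n}) f))"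
    if "f \<in> Arr (Ar {0..n})" for f
    using that pm A.Dom_Obj[OF that] A.Cod_Obj[OF that]
    by (cases f) (auto simp: edge_simplex_sel hom_Fin_pt Ar_simps(3-))
  show ?thesis
    unfolding is_functor_def
  proof (intro conjI ballI impI)
    show "omap ?X \<in> Obj (Ar {0..n}) \<rightarrow>\<^sub>E Obj Fin_pt" by (simp add: edge_simplex_def)
    have "amap ?X \<in> extensional (Arr (Ar {0..n}))" by (simp add: edge_simplex_def)
    then show "amap ?X \<in> Arr (Ar {0..n}) \<rightarrow>\<^sub>E Arr Fin_pt"
      using hom by (auto simp: PiE_def hom_def)
    show "amap ?X (Idn (Ar {0..n}) x) = Idn Fin_pt (omap ?X x)" if x: "x \<in> Obj (Ar {0..n})" for x
      using A.Idn_hom[OF x] x by (simp add: edge_simplex_sel Ar_simps(3-) hom_def)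
    fix f g assume f: "f \<in> Arr (Ar {0..n})" and g: "g \<in> Arr (Ar {0..n})" and e: "Cod (Ar {0..n}) f = Dom (Ar {0..n}) g"
    obtain x y z where xyz: "f = (x, y)" "g = (y, z)" using e by (cases f; cases g) (auto simp: Ar_simps(3-))
    have "Cmp (Ar {0..n}) g f \<in> Arr (Ar {0..n})"
      using A.Cmp_hom[of f x y g z] f g by (simp add: hom_def xyz Ar_simps(3-))
    then have xz: "(x, z) \<in> Arr (Ar {0..n})" by (simp add: xyz Ar_simps(3-))
    have "Id_on (?v x \<inter> ?v y) O Id_on (?v y \<inter> ?v z) = Id_on (?v x \<inter> ?v z)"
      using tr[of x y z] f g unfolding xyz Id_on_relcomp by (intro arg_cong[where f = Id_on]) blast
    then show "amap ?X (Cmp (Ar {0..n}) g f) = Cmp Fin_pt (amap ?X g) (amap ?X f)"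
      using f g xz unfolding xyz
      by (simp add: edge_simplex_sel Ar_simps(3-) Cmp_eq_iff[THEN iffD2, THEN sym] Cmp_eq_iff eq_commute[of "pmap _ _ _"])
  qed (rule hom)
qed

lemma edge_simplex_Obj: "edge_simplex n j \<in> Obj (Sdot Fin_pt {0..n})"
proof -
  let ?X = "edge_simplex n j" and ?v = "\<lambda>x. set_decode (edge_val j x)"
  interpret category_with_cofibrations Fin_pt by (rule category_with_cofibrations_Fin_pt)
  have "cofibration_sequence Fin_pt (amap ?X ((i, q), (i, k))) (amap ?X ((i, k), (q, k)))"
    if iqk: "i < q" "q < k" "k \<le> n" for i q k
  proof -
    let ?f = "amap ?X ((i, q), (i, k))" and ?p = "amap ?X ((i, k), (q, k))"
    have f: "src ?f = edge_val j (i, q)" "tgt ?f = edge_val j (i, k)" "graph ?f = Id_on (?v (i, q) \<inter> ?v (i, k))"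
      and p: "src ?p = edge_val j (i, k)" "tgt ?p = 0" "graph ?p = {}"
      using iqk by (auto simp: edge_simplex_sel Ar_simps(1,2) edge_val_def)
    have fA: "?f \<in> Arr Fin_pt" and pA: "?p \<in> Arr Fin_pt"
      using f p by (auto simp: Arr_Fin_pt is_pmap_def single_valued_def)
    \<comment> \<open>If entry \<open>(i, k)\<close> is \<open>V\<close>, so is
      \<open>(i, q)\<close>. Thus \<open>?f\<close> is onto and has cokernel \<open>0\<close>, which
      is the entry at \<open>(q, k)\<close> because \<open>q > 0\<close>.\<close>
    have sub: "?v (i, k) \<subseteq> ?v (i, q)"
      using iqk by (auto simp: edge_val_def)
    have "is_pushout Fin_pt ?f (pmap (src ?f) 0 {}) ?p (pmap 0 0 {})"
    proof (rule is_pushout_Fin_ptI[where d = 0])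
      fix z U V
      assume U: "is_pmap (tgt ?f) z U" and V: "is_pmap (tgt (pmap (src ?f) 0 {})) z V"
        and e: "graph ?f O U = graph (pmap (src ?f) 0 {}) O V"
      have "U = {}" "V = {}"
        using U V e sub by (fastforce simp: is_pmap_def f)+
      then show "\<exists>W. is_pmap 0 z W \<and> graph ?p O W = U \<and> graph (pmap 0 0 {}) O W = V"
        by (auto simp: is_pmap_def)
    qed (use fA in \<open>auto simp: Arr_Fin_pt hom_Fin_pt is_pmap_def f p\<close>)
    moreover have "?f \<in> Cof Fin_pt" using fA by (auto simp: Cof_Fin_pt f single_valued_def)
    moreover have "pmap (src ?f) 0 {} \<in> hom Fin_pt (src ?f) 0" "pmap 0 0 {} \<in> hom Fin_pt 0 0"
      by (auto simp: hom_Fin_pt is_pmap_def)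
    ultimately show ?thesis
      using pA p f unfolding cofibration_sequence_def by auto
  qed
  then show ?thesis
    using is_functor_edge_simplex by (auto simp: Sdot_Obj edge_simplex_sel Ar_simps edge_val_def)
qed

text \<open>The two families of entries differ at most at \<open>(0, j)\<close>, an object of
  \<open>Ar I\<close> only if \<open>I\<close> contains both \<open>0\<close> and
  \<open>j\<close>.\<close>

lemma edge_simplex_res_eq:
  assumes "I \<subseteq> {0..n}" "\<not> (0 \<in> I \<and> j \<in> I)"
  shows "omap (Sdot_res Fin_pt {0..n} I) (edge_simplex n j) = omap (Sdot_res Fin_pt {0..n} I) (edge_simplex n (j - 1))"
proof -
  have v: "edge_val j x = edge_val (j - 1) x" if "x \<in> Obj (Ar I)" for x
  proof -
    obtain a b where x: "x = (a, b)" "a \<in> I" "b \<in> I" using \<open>x \<in> Obj (Ar I)\<close> by (auto simp: Ar_simps)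
    then have "a = 0 \<Longrightarrow> b \<noteq> j" using assms(2) by auto
    then show ?thesis by (auto simp: edge_val_def x)
  qed
  have sub: "Obj (Ar I) \<subseteq> Obj (Ar {0..n})" "Arr (Ar I) \<subseteq> Arr (Ar {0..n})"
    using assms(1) by (auto simp: Ar_simps)
  interpret A: category "Ar I" by (rule category_Ar)
  have "comp_fctr (Ar I) (edge_simplex n j) (Ar_map I (\<lambda>i. i)) = comp_fctr (Ar I) (edge_simplex n (j - 1)) (Ar_map I (\<lambda>i. i))"
  proof -
    have "omap (edge_simplex n j) x = omap (edge_simplex n (j - 1)) x" if "x \<in> Obj (Ar I)" for x
      using subsetD[OF sub(1) that] v[OF that] by (simp add: edge_simplex_sel)
    moreover have "amap (edge_simplex n j) f = amap (edge_simplex n (j - 1)) f" if "f \<in> Arr (Ar I)" for f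
      using that sub v A.Dom_Obj[OF that] A.Cod_Obj[OF that]
      by (cases f) (auto simp: edge_simplex_sel Ar_simps(3-) subset_iff)
    ultimately show ?thesis
      by (auto simp: comp_fctr_def Ar_map_def map_prod_def split_def intro!: restrict_ext)
  qed
  then show ?thesis using edge_simplex_Obj by (simp add: Sdot_map_def)
qed

section \<open>Separating the two simplices up to isomorphism\<close>

lemma equivalence_reflects_retract:
  assumes "category C" and F: "equivalence_of_categories C D F" and a: "a \<in> Obj C" and b: "b \<in> Obj C"
    and ab: "omap F a = omap F b"
  obtains f g where "f \<in> hom C a b" "g \<in> hom C b a" "Cmp C g f = Idn C a"
proof -
  interpret category C by fact
  obtain G where "isomorphic (functor_cat C C) (comp_fctr C G F) (id_fctr C)"
    using F by (auto simp: equivalence_of_categories_def)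
  then obtain \<phi> \<psi> where h: "\<phi> \<in> hom (functor_cat C C) (comp_fctr C G F) (id_fctr C)"
      "\<psi> \<in> hom (functor_cat C C) (id_fctr C) (comp_fctr C G F)"
    and e: "Cmp (functor_cat C C) \<psi> \<phi> = Idn (functor_cat C C) (comp_fctr C G F)"
      "Cmp (functor_cat C C) \<phi> \<psi> = Idn (functor_cat C C) (id_fctr C)"
    by (auto simp: isomorphic_def is_iso_def hom_def)
  then obtain \<tau> \<sigma> where ts: "\<phi> = (comp_fctr C G F, id_fctr C, \<tau>)" "\<psi> = (id_fctr C, comp_fctr C G F, \<sigma>)"
      "nat_trans C C (comp_fctr C G F) (id_fctr C) \<tau>" "nat_trans C C (id_fctr C) (comp_fctr C G F) \<sigma>"
    by (auto simp: hom_def functor_cat_def)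
  \<comment> \<open>As \<open>F\<close> takes equal values on \<open>a\<close> and \<open>b\<close>,
    the object \<open>c\<close> is the common value of \<open>G F\<close> on both. The isomorphism
    of \<open>G F\<close> with the identity then links \<open>a\<close> to \<open>b\<close> through
    \<open>c\<close>.\<close>
  define c where "c = omap G (omap F a)"
  have \<tau>: "\<tau> a \<in> hom C c a" "\<tau> b \<in> hom C c b" and \<sigma>: "\<sigma> a \<in> hom C a c" "\<sigma> b \<in> hom C b c"
    using nat_transD(1)[OF ts(3), of a] nat_transD(1)[OF ts(3), of b]
      nat_transD(1)[OF ts(4), of a] nat_transD(1)[OF ts(4), of b] a b ab
    by (simp_all add: comp_fctr_def id_fctr_def c_def)
  have "Cmp C (\<sigma> b) (\<tau> b) = Idn C c"
    using e(1) b ab by (auto simp: ts functor_cat_def comp_fctr_def c_def dest!: fun_cong[where x = b])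
  moreover have ta: "Cmp C (\<tau> a) (\<sigma> a) = Idn C a"
    using e(2) a by (auto simp: ts functor_cat_def id_fctr_def dest!: fun_cong[where x = a])
  moreover have "Cmp C (Cmp C (\<tau> a) (\<sigma> b)) (Cmp C (\<tau> b) (\<sigma> a)) = Cmp C (\<tau> a) (Cmp C (Cmp C (\<sigma> b) (\<tau> b)) (\<sigma> a))"
    using Cmp_assoc[OF Cmp_hom[OF \<sigma>(1) \<tau>(2)] \<sigma>(2) \<tau>(1)] Cmp_assoc[OF \<sigma>(1) \<tau>(2) \<sigma>(2)] by simp
  ultimately have "Cmp C (Cmp C (\<tau> a) (\<sigma> b)) (Cmp C (\<tau> b) (\<sigma> a)) = Idn C a"
    using Cmp_Idn_left[OF \<sigma>(1)] by simp
  then show ?thesis using that Cmp_hom[OF \<sigma>(1) \<tau>(2)] Cmp_hom[OF \<sigma>(2) \<tau>(1)] by blast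
qed

text \<open>At the entry \<open>(0, j)\<close> the identity of \<open>V\<close> would factor through
  the zero object.\<close>

lemma edge_simplex_not_retract:
  assumes "0 < j" "j \<le> n"
    and f: "f \<in> hom (Sdot Fin_pt {0..n}) (edge_simplex n j) (edge_simplex n (j - 1))"
    and g: "g \<in> hom (Sdot Fin_pt {0..n}) (edge_simplex n (j - 1)) (edge_simplex n j)"
  shows "Cmp (Sdot Fin_pt {0..n}) g f \<noteq> Idn (Sdot Fin_pt {0..n}) (edge_simplex n j)"
proof
  assume e: "Cmp (Sdot Fin_pt {0..n}) g f = Idn (Sdot Fin_pt {0..n}) (edge_simplex n j)"
  let ?X = "edge_simplex n j" and ?Y = "edge_simplex n (j - 1)"
  obtain \<tau> \<sigma> where ts: "f = (?X, ?Y, \<tau>)" "g = (?Y, ?X, \<sigma>)"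
      "nat_trans (Ar {0..n}) Fin_pt ?X ?Y \<tau>"
    using f g by (cases f; cases g) (auto simp: hom_def Sdot_simps Sdot_Arr)
  have O: "(0, j) \<in> Obj (Ar {0..n})" using assms by (simp add: Ar_simps)
  have v: "edge_val j (0, j) = 1" "edge_val (j - 1) (0, j) = 0" using assms by (auto simp: edge_val_def)
  have "\<tau> (0, j) \<in> hom Fin_pt 1 0"
    using nat_transD(1)[OF ts(3) O] by (simp add: edge_simplex_sel O v del: One_nat_def)
  then have "graph (\<tau> (0, j)) = {}" by (auto simp: hom_Fin_pt is_pmap_def)
  moreover have "Cmp Fin_pt (\<sigma> (0, j)) (\<tau> (0, j)) = Idn Fin_pt 1"
    using e O v by (auto simp: ts Sdot_simps edge_simplex_sel dest!: fun_cong[where x = "(0, j)"])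
  then have "graph (\<tau> (0, j)) O graph (\<sigma> (0, j)) = {(0, 0)}"
    by (simp add: Cmp_eq_iff set_decode_one Id_on_def)
  ultimately show False by simp
qed


section \<open>Crossing diagonals\<close>

text \<open>Twice the signed area of the triangle, positive if \<open>a\<close>, \<open>b\<close>,
  \<open>c\<close> run counterclockwise.\<close>

definition orient :: "complex \<Rightarrow> complex \<Rightarrow> complex \<Rightarrow> real" where
  "orient a b c = Im (cnj (b - a) * (c - a))"

text \<open>The signed areas of the four triangles are the coefficients of an affine dependence
  between the four points. Divided by \<open>s\<close>, twice the area of the quadrilateral, it
  expresses one point as a convex combination of \<open>a\<close> and \<open>c\<close> and also of
  \<open>b\<close> and \<open>d\<close>.\<close>

lemma crossing_segments:
  assumes pos: "orient a b c > 0" "orient a b d > 0" "orient a c d > 0" "orient b c d > 0"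
  shows "\<exists>x \<in> open_segment a c. x \<in> closed_segment b d"
proof -
  define s where "s = orient b c d + orient a b d"
  have s: "s = orient a c d + orient a b c" "s > 0"
    using pos by (simp_all add: s_def orient_def algebra_simps)
  have "orient b c d *\<^sub>R a + orient a b d *\<^sub>R c = orient a c d *\<^sub>R b + orient a b c *\<^sub>R d"
    by (simp add: complex_eq_iff orient_def algebra_simps)
  then have "(1 / s) *\<^sub>R (orient b c d *\<^sub>R a + orient a b d *\<^sub>R c) = (1 / s) *\<^sub>R (orient a c d *\<^sub>R b + orient a b c *\<^sub>R d)"
    by simp
  moreover have "orient b c d / s = 1 - orient a b d / s"
    using s(2) unfolding s_def by (simp add: field_simps)
  moreover have "orient a c d / s = 1 - orient a b c / s"
    using s(2) unfolding s(1) by (simp add: field_simps)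
  ultimately have eq: "(1 - orient a b d / s) *\<^sub>R a + (orient a b d / s) *\<^sub>R c =
      (1 - orient a b c / s) *\<^sub>R b + (orient a b c / s) *\<^sub>R d"
    by (simp add: scaleR_add_right)
  have "a \<noteq> c" using pos(1) by (auto simp: orient_def mult.commute)
  moreover have "0 < orient a b d / s" "orient a b d / s < 1" "0 \<le> orient a b c / s" "orient a b c / s \<le> 1"
    using pos s by (auto simp: s_def divide_simps)
  ultimately show ?thesis
    using eq unfolding in_segment bex_simps by (metis in_segment(1,2))
qed

text \<open>With half the central angles as parameters, the area of an inscribed triangle becomes a
  product of sines, whose sign can be read off.\<close>

lemma orient_cis: "orient (cis A) (cis (A + 2 * x)) (cis (A + 2 * x + 2 * y)) = 4 * sin x * sin y * sin (x + y)"
proof -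
  have "orient (cis A) (cis B) (cis C) = sin (B - A) + sin (C - B) - sin (C - A)" for B C
    by (simp add: orient_def sin_diff algebra_simps)
  from this[of "A + 2 * x" "A + 2 * x + 2 * y"]
  have "orient (cis A) (cis (A + 2 * x)) (cis (A + 2 * x + 2 * y)) = sin (2 * x) + sin (2 * y) - sin (2 * (x + y))"
    by (simp add: add.assoc distrib_left)
  also have "\<dots> = 2 * sin x * cos x + 2 * sin y * cos y - 2 * (sin x * cos y + cos x * sin y) * (cos x * cos y - sin x * sin y)"
    by (simp only: sin_double sin_add[of x y] cos_add[of x y])
  also have "\<dots> = 4 * sin x * sin y * (sin x * cos y + cos x * sin y)"
    using sin_cos_squared_add[of x] sin_cos_squared_add[of y] by algebra
  finally show ?thesis by (simp add: sin_add)
qed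

lemma sin_angle_pos:
  assumes "0 < d" "d < real (n + 1)"
  shows "sin (pi * d / real (n + 1)) > 0"
proof (rule sin_gt_zero)
  have "pi * (d / real (n + 1)) < pi * 1"
    using assms by (intro mult_strict_left_mono) simp_all
  then show "pi * d / real (n + 1) < pi" by simp
qed (use assms in simp)

text \<open>Two of the vertices are at most \<open>n\<close> of the \<open>n + 1\<close> steps
  apart, so all half angles lie strictly between 0 and pi and the three sines in
  \<open>orient_cis\<close> are positive.\<close>

lemma orient_polygon_vertex:
  assumes "i < j" "j < k" "k \<le> n"
  shows "orient (polygon_vertex n i) (polygon_vertex n j) (polygon_vertex n k) > 0"
proof -
  define x where "x = pi * (real j - real i) / real (n + 1)"
  define y where "y = pi * (real k - real j) / real (n + 1)"
  have v: "polygon_vertex n j = cis (2 * pi * real i / real (n + 1) + 2 * x)"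
    "polygon_vertex n k = cis (2 * pi * real i / real (n + 1) + 2 * x + 2 * y)"
    by (simp_all add: polygon_vertex_def x_def y_def diff_divide_distrib add_divide_distrib algebra_simps)
  from sin_angle_pos[of "real j - real i" n] sin_angle_pos[of "real k - real j" n]
    sin_angle_pos[of "real k - real i" n]
  have "sin x > 0" "sin y > 0" "sin (x + y) > 0"
    using assms by (simp_all add: x_def y_def add_divide_distrib[symmetric] distrib_left[symmetric] del: of_nat_Suc)
  then show ?thesis
    unfolding v by (simp add: polygon_vertex_def[of n i] orient_cis)
qed

text \<open>Vertex \<open>0\<close> is the complex number 1, while the other vertices lie in the
  convex open half plane \<open>Re z < 1\<close>.\<close>

lemma vertex_0_notin_hull:
  assumes "t \<subseteq> {1..n}"
  shows "polygon_vertex n 0 \<notin> convex hull (polygon_vertex n ` t)"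
proof -
  have "Re (polygon_vertex n k) < 1" if "k \<in> t" for k
  proof -
    define x where "x = pi * real k / real (n + 1)"
    have "0 < k" "k < n + 1" using that assms by auto
    then have "sin x > 0" using sin_angle_pos[of "real k" n] by (simp add: x_def del: of_nat_Suc)
    moreover have "polygon_vertex n k = cis (2 * x)" by (simp add: polygon_vertex_def x_def mult.assoc)
    ultimately show ?thesis by (simp add: cos_double_sin)
  qed
  then have "convex hull (polygon_vertex n ` t) \<subseteq> {z. Re z < 1}"
    by (intro hull_minimal convex_halfspace_Re_lt) auto
  then show ?thesis by (auto simp: polygon_vertex_def)
qed

text \<open>If \<open>{p < q < r}\<close> is a triangle with \<open>0 < p\<close>, then the chord from \<open>0\<close> to \<open>q\<close> crosses its edge
  from \<open>p\<close> to \<open>r\<close>, so that it cannot lie in a triangle.\<close>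

lemma vertex_not_joined_to_0:
  assumes T: "polygon_triangulation n \<Delta>" and t: "t \<in> \<Delta>" "0 \<notin> t"
  obtains j where "0 < j" "j \<le> n" "\<And>s. s \<in> \<Delta> \<Longrightarrow> \<not> (0 \<in> s \<and> j \<in> s)"
proof -
  let ?v = "polygon_vertex n" and ?h = "\<lambda>t. convex hull (polygon_vertex n ` t)"
  have t3: "t \<subseteq> {0..n}" "card t = 3" using T t by (auto simp: polygon_triangulation_def)
  have sub: "t \<subseteq> {1..n}" using t3(1) t(2) by (fastforce simp: Suc_le_eq intro: gr0I)
  obtain p q r where pqr: "t = {p, q, r}" "p < q" "q < r"
  proof -
    have "finite t" using t3 by (auto intro: finite_subset)
    then obtain l where l: "sorted_wrt (<) l" "set l = t" "length l = 3"
      using t3(2) by (metis finite_sorted_distinct_unique distinct_card strict_sorted_iff)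
    then obtain a b c where "l = [a, b, c]" by (auto simp: length_Suc_conv numeral_3_eq_3)
    then show ?thesis using l that[of a b c] by auto
  qed
  have p: "0 < p" "r \<le> n" using sub pqr by auto
  obtain x where x: "x \<in> open_segment (?v 0) (?v q)" "x \<in> closed_segment (?v p) (?v r)"
    using crossing_segments[of "?v 0" "?v p" "?v q" "?v r"] orient_polygon_vertex pqr p by (meson less_trans less_imp_le order_less_le_trans)
  have "\<not> (0 \<in> s \<and> q \<in> s)" if s: "s \<in> \<Delta>" for s
  proof
    assume 0: "0 \<in> s \<and> q \<in> s"
    \<comment> \<open>The cells meet in a face of \<open>?h s\<close>. This face contains
      \<open>x\<close>, an interior point of a segment in \<open>?h s\<close>, hence also the end
      point \<open>?v 0\<close> of that segment.\<close>
    have "(?h s \<inter> ?h t) face_of ?h s"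
      using T t s by (auto simp: polygon_triangulation_def triangulation_def)
    moreover have h: "?v 0 \<in> ?h s" "?v q \<in> ?h s" "?v p \<in> ?h t" "?v r \<in> ?h t"
      using 0 pqr by (auto intro: hull_inc)
    moreover have "x \<in> ?h s" "x \<in> ?h t"
      using x closed_segment_subset[OF h(1,2) convex_convex_hull] closed_segment_subset[OF h(3,4) convex_convex_hull]
        segment_open_subset_closed[of "?v 0" "?v q"] by blast+
    ultimately have "?v 0 \<in> ?h t" using x(1) face_ofD by blast
    then show False using vertex_0_notin_hull[OF sub] by blast
  qed
  then show ?thesis using that[of q] p pqr by auto
qed


theorem proposition8p6:
  fixes n :: nat and \<Delta> :: "nat set set"
  assumes "n \<ge> 3"
    and "polygon_triangulation n \<Delta>"
    and "\<exists>t \<in> \<Delta>. 0 \<notin> t"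
  shows "\<exists>C :: (nat, nat) cof_cat. category_with_cofibrations C \<and>
           \<not> equivalence_of_categories (Sdot C {0..n}) (two_segal_target (Sdot C) (Sdot_res C) n \<Delta>)
               (two_segal_map (Sdot C) (Sdot_res C) n \<Delta>)"
proof (intro exI conjI notI)
  show C: "category_with_cofibrations Fin_pt" by (rule category_with_cofibrations_Fin_pt)
  let ?S = "Sdot Fin_pt {0..n}" and ?f = "two_segal_map (Sdot Fin_pt) (Sdot_res Fin_pt) n \<Delta>"
  assume E: "equivalence_of_categories ?S (two_segal_target (Sdot Fin_pt) (Sdot_res Fin_pt) n \<Delta>) ?f"
  obtain j where j: "0 < j" "j \<le> n" "\<And>s. s \<in> \<Delta> \<Longrightarrow> \<not> (0 \<in> s \<and> j \<in> s)"
    using vertex_not_joined_to_0 assms(2,3) by metis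
  let ?X = "edge_simplex n j" and ?Y = "edge_simplex n (j - 1)"
  have "omap (Sdot_res Fin_pt {0..n} I) ?X = omap (Sdot_res Fin_pt {0..n} I) ?Y" if I: "I \<in> \<Delta> \<union> diagonals n \<Delta>" for I
  proof -
    \<comment> \<open>A diagonal is contained in a triangle, so it cannot contain both
      \<open>0\<close> and \<open>j\<close> either.\<close>
    obtain t where "t \<in> \<Delta>" "I \<subseteq> t" using I by (auto simp: diagonals_def)
    moreover have "t \<subseteq> {0..n}" using assms(2) \<open>t \<in> \<Delta>\<close> by (auto simp: polygon_triangulation_def)
    ultimately show ?thesis using j(3)[of t] by (intro edge_simplex_res_eq) auto
  qed
  \<comment> \<open>The image of a simplex consists of its restrictions and of their identities as
    comparison maps, so the two images are equal and not just isomorphic.\<close>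
  then have "omap ?f ?X = omap ?f ?Y"
    using edge_simplex_Obj by (auto simp: two_segal_map_def Let_def le_pairs_def intro!: restrict_ext)
  then obtain f g where "f \<in> hom ?S ?X ?Y" "g \<in> hom ?S ?Y ?X" "Cmp ?S g f = Idn ?S ?X"
    using equivalence_reflects_retract[OF category_Sdot[OF category_Fin_pt] E edge_simplex_Obj edge_simplex_Obj]
    by metis
  then show False using edge_simplex_not_retract[OF j(1,2)] by blast
qed

end
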